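(* Let $f,g:\mathbb{R}\to\mathbb{R}$ satisfy: $f,g\in C^\infty(\mathbb{R})$; $f(0)=0$ and $f''(x)\ge 0$ for all $x\in\mathbb{R}$; $g(x)\ge 0$ for all $x\in\mathbb{R}$, and $g(x)=0$ if and only if $x=0$. Let $T>0$, $s>3/2$, and let $u\in C^0([0,T];H^s(\mathbb{R}))$ be a solution of $$u_t+f'(u)u_x+\partial_x\Lambda^{-2}\Big(g(u)+\frac{f''(u)}{2}u_x^2\Big)=0 .$$ If there exists a non-empty open set $\Omega\subseteq[0,T]\times\mathbb{R}$ on which $u$ vanishes, then $u$ is trivial, i.e. $u$ vanishes everywhere.
   Context: Functions are real-valued, $t$ denotes time and $x$ space. $\Lambda^{-2}=(1-\partial_x^2)^{-1}$ is the inverse Helmholtz operator: $\Lambda^{-2}h=p\ast h$ and $\partial_x\Lambda^{-2}h=(\partial_x p)\ast h$, where $p(x)=\tfrac12 e^{-|x|}$, $\partial_xp(x)=-\mathrm{sgn}(x)p(x)$ and $\ast$ is convolution in $x$. $H^s(\mathbb{R})$ is the usual Sobolev space. By local well-posedness theory such solutions also belong to $C^1([0,T];H^{s-1}(\mathbb{R}))$. *)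

theory Defs
  imports "HOL-Analysis.Analysis"
begin

definition smooth :: "(real \<Rightarrow> real) \<Rightarrow> bool" where
  "smooth f \<longleftrightarrow> (\<forall>n x. (deriv ^^ n) f differentiable (at x))"

definition square_integrable :: "(real \<Rightarrow> complex) \<Rightarrow> bool" where
  "square_integrable h \<longleftrightarrow>
     h \<in> borel_measurable lborel \<and> integrable lborel (\<lambda>x. (norm (h x))\<^sup>2)"

text \<open>The Fourier transform on \<open>L\<^sup>2\<close>, unitary normalisation: the \<open>L\<^sup>2\<close>-limit as
  \<open>R \<rightarrow> \<infinity>\<close> of the transforms of the truncations of \<open>h\<close> to \<open>[-R, R]\<close>. It is determined up
  to null sets, hence a relation. The \<open>L\<^sup>2\<close> distance is a nonnegative integral, so that an
  infinite distance is not read as zero.\<close>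

definition truncated_fourier :: "(real \<Rightarrow> complex) \<Rightarrow> real \<Rightarrow> real \<Rightarrow> complex" where
  "truncated_fourier h R \<xi> =
     complex_of_real (1 / sqrt (2 * pi)) * (LINT x:{-R..R}|lborel. h x * cis (- (x * \<xi>)))"

definition is_fourier_L2 :: "(real \<Rightarrow> complex) \<Rightarrow> (real \<Rightarrow> complex) \<Rightarrow> bool" where
  "is_fourier_L2 h F \<longleftrightarrow> square_integrable h \<and> square_integrable F \<and>
     ((\<lambda>R. \<integral>\<^sup>+\<xi>. ennreal ((norm (F \<xi> - truncated_fourier h R \<xi>))\<^sup>2) \<partial>lborel) \<longlongrightarrow> 0) at_top"

definition fourier_L2 :: "(real \<Rightarrow> complex) \<Rightarrow> real \<Rightarrow> complex" where
  "fourier_L2 h = (SOME F. is_fourier_L2 h F)"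

text \<open>The real-valued Sobolev space \<open>H\<^sup>s\<close> on the line, for \<open>s \<ge> 0\<close> only: elements of \<open>H\<^sup>s\<close>
  with \<open>s < 0\<close> need not be functions. Members are representatives, not classes modulo null sets.\<close>

definition sobolev :: "real \<Rightarrow> (real \<Rightarrow> real) set" where
  "sobolev s = {h. \<exists>F. is_fourier_L2 (\<lambda>x. complex_of_real (h x)) F \<and>
     integrable lborel (\<lambda>\<xi>. (1 + \<xi>\<^sup>2) powr s * (norm (F \<xi>))\<^sup>2)}"

definition sobolev_norm :: "real \<Rightarrow> (real \<Rightarrow> real) \<Rightarrow> real" where
  "sobolev_norm s h = sqrt (LINT \<xi>|lborel.
     (1 + \<xi>\<^sup>2) powr s * (norm (fourier_L2 (\<lambda>x. complex_of_real (h x)) \<xi>))\<^sup>2)"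

text \<open>\<open>C\<^sup>0([0,T]; H\<^sup>s)\<close>, with \<open>u t\<close> the spatial profile at time \<open>t\<close>.\<close>

definition C0_sobolev :: "real \<Rightarrow> real \<Rightarrow> (real \<Rightarrow> real \<Rightarrow> real) set" where
  "C0_sobolev T s = {u. (\<forall>t\<in>{0..T}. u t \<in> sobolev s) \<and>
     (\<forall>t\<in>{0..T}. ((\<lambda>\<tau>. sobolev_norm s (\<lambda>x. u \<tau> x - u t x)) \<longlongrightarrow> 0) (at t within {0..T}))}"

definition helmholtz_kernel :: "real \<Rightarrow> real" where
  "helmholtz_kernel x = exp (- \<bar>x\<bar>) / 2"

definition convolve :: "(real \<Rightarrow> real) \<Rightarrow> (real \<Rightarrow> real) \<Rightarrow> real \<Rightarrow> real" where
  "convolve k h x = (LINT y|lborel. k (x - y) * h y)"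

text \<open>\<open>\<partial>\<^sub>x \<Lambda>\<^sup>-\<^sup>2 h = (\<partial>\<^sub>x p) * h\<close>, where \<open>p\<close> is \<^const>\<open>helmholtz_kernel\<close> and \<open>\<partial>\<^sub>x p = - sgn p\<close>.\<close>

definition dx_inv_helmholtz :: "(real \<Rightarrow> real) \<Rightarrow> real \<Rightarrow> real" where
  "dx_inv_helmholtz h = convolve (\<lambda>x. - sgn x * helmholtz_kernel x) h"

text \<open>For \<open>s > 3/2\<close> the continuous representative of an element of \<open>H\<^sup>s\<close> is continuously
  differentiable, and every term of the equation other than \<open>u\<^sub>t\<close> is continuous in \<open>(t, x)\<close>.
  The equation is therefore read pointwise, with one-sided time derivatives at \<open>0\<close> and \<open>T\<close>;
  this also follows if it holds in \<open>C\<^sup>0([0,T]; H\<^sup>s\<^sup>-\<^sup>1)\<close> for \<open>u \<in> C\<^sup>1([0,T]; H\<^sup>s\<^sup>-\<^sup>1)\<close>.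
  The notion is meaningful only for profiles \<open>u t\<close> that are these continuous representatives.\<close>

definition is_solution ::
    "(real \<Rightarrow> real) \<Rightarrow> (real \<Rightarrow> real) \<Rightarrow> real \<Rightarrow> (real \<Rightarrow> real \<Rightarrow> real) \<Rightarrow> bool" where
  "is_solution f g T u \<longleftrightarrow> (\<forall>t\<in>{0..T}. \<forall>x. \<exists>u\<^sub>t.
     ((\<lambda>\<tau>. u \<tau> x) has_real_derivative u\<^sub>t) (at t within {0..T}) \<and>
     u\<^sub>t + deriv f (u t x) * deriv (u t) x
        + dx_inv_helmholtz
            (\<lambda>y. g (u t y) + deriv (deriv f) (u t y) / 2 * (deriv (u t) y)\<^sup>2) x = 0)"

end

(* At an interior point of Omega both u_t and u_x vanish, so the equation says that the nonlocal
   term of the nonnegative density h = g(u) + f''(u) u_x^2 / 2 vanishes on an interval where h = 0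
   as well. There d/dx of that term is p * h, a strictly positive average of h, so h = 0 everywhere;
   since g vanishes only at 0, the whole profile u(t) is zero.

   It remains to see that the zero profile propagates in time. The equation is a transport equation
   with velocity f'(u) whose right-hand side and its Lipschitz constant are O(m) when |u| and |u_x|
   are at most m. A maximum principle for difference quotients shows that, on a time interval of
   fixed length, the bound m improves to m / 2; iterating gives u = 0 there, in both time directions.
   The initial bound is the embedding of H^s into C^1 for s > 3/2, obtained from Fourier inversion,
   which is in turn tested on Gaussians. *)
theory Submission
  imports Defs "HOL-Probability.Characteristic_Functions" "HOL-Real_Asymp.Real_Asymp"
begin

section \<open>The nonlocal operator\<close>

text \<open>The profiles are in general only once differentiable in space, and the density contains
  the square of u_x. The equation can therefore not be differentiated in x in order to follow u_x
  along characteristics. What survives is that the convolution of a merely bounded density with a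
  kernel that jumps is Lipschitz, with a constant proportional to the bound. So u_x is controlled
  through Lipschitz quotients of u, by a maximum principle in two space variables that uses
  first-order conditions alone. Comparison with the zero solution works because every estimate is
  linear in m: g(u) = O(m) since g(0) = 0, and of the two factors u_x one is absorbed by the a
  priori bound B. Hence one length of time serves all m at once. The Fourier transform is available
  only as an L2 limit of truncated transforms. Pairing with Gaussians needs Fubini for the
  truncations and Cauchy-Schwarz for the limit, and takes the place of Plancherel's theorem. For a
  continuous representative the resulting formula holds at every point, not just almost
  everywhere.\<close>

lemma integrable_comp_abs:
  fixes f F :: "real \<Rightarrow> real"
  assumes [measurable]: "f \<in> borel_measurable borel"
    and F: "\<And>x. 0 \<le> x \<Longrightarrow> DERIV F x :> f x" and pos: "\<And>x. 0 \<le> x \<Longrightarrow> 0 \<le> f x"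
    and lim: "(F \<longlongrightarrow> l) at_top"
  shows "integrable lborel (\<lambda>x. f \<bar>x\<bar>)"
proof -
  define g where "g x = f x * indicator {0..} x" for x
  have [measurable]: "g \<in> borel_measurable borel" unfolding g_def by measurable
  have gpos: "0 \<le> g x" for x by (auto simp: g_def indicator_def pos)
  have "(\<integral>\<^sup>+x. ennreal (g x) \<partial>lborel) = (\<integral>\<^sup>+x. ennreal (f x) * indicator {0..} x \<partial>lborel)"
    by (auto intro!: nn_integral_cong simp: g_def indicator_def)
  also have "\<dots> = ennreal (l - F 0)"
    by (rule nn_integral_FTC_atLeast) (use F pos lim in auto)
  finally have "integrable lborel g"
    using gpos by (intro integrableI_nonneg) auto
  moreover from this have "integrable lborel (\<lambda>x. g (0 + (-1) * x))"
    by (rule lborel_integrable_real_affine) simp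
  \<comment> \<open>Reflection of the half-line part. At 0 both summands contribute, so the sum is a
    majorant of \<open>f \<bar>x\<bar>\<close> and not equal to it.\<close>
  ultimately have "integrable lborel (\<lambda>x. g x + g (- x))"
    by simp
  then show ?thesis
    by (rule Bochner_Integration.integrable_bound) (auto simp: g_def indicator_def pos)
qed

lemma integrable_exp_minus_abs: "integrable lborel (\<lambda>y::real. exp (- \<bar>x - y\<bar>))"
proof -
  have "((\<lambda>x::real. - exp (- x)) \<longlongrightarrow> - 0) at_top"
    by (intro tendsto_minus filterlim_compose[OF exp_at_bot filterlim_uminus_at_bot_at_top])
  then have "integrable lborel (\<lambda>y::real. exp (- \<bar>y\<bar>))"
    by (intro integrable_comp_abs[where f = "\<lambda>x. exp (- x)" and F = "\<lambda>x. - exp (- x)"])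
      (auto intro!: derivative_eq_intros)
  from lborel_integrable_real_affine[OF this, of "-1" x] show ?thesis
    by simp
qed

lemma integral_exp_minus_abs_translate:
  "(LINT y|lborel. exp (- \<bar>x - y\<bar>)) = (LINT y|lborel. exp (- \<bar>y :: real\<bar>))"
  using lborel_integral_real_affine[of "-1" "\<lambda>y. exp (- \<bar>y :: real\<bar>)" x] by simp

definition dx_kernel :: "real \<Rightarrow> real \<Rightarrow> real" where
  "dx_kernel x y = - sgn (x - y) * exp (- \<bar>x - y\<bar>) / 2"

lemma dx_inv_helmholtz_eq: "dx_inv_helmholtz h x = (LINT y|lborel. dx_kernel x y * h y)"
  by (simp add: dx_inv_helmholtz_def convolve_def helmholtz_kernel_def dx_kernel_def)

lemma dx_kernel_measurable [measurable]: "dx_kernel x \<in> borel_measurable borel"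
  unfolding dx_kernel_def by measurable

lemma abs_dx_kernel_le: "\<bar>dx_kernel x y\<bar> \<le> exp (- \<bar>x - y\<bar>)"
  by (auto simp: dx_kernel_def sgn_if)

lemma integrable_dx_kernel_mult:
  assumes [measurable]: "h \<in> borel_measurable borel" and "\<And>y. \<bar>h y\<bar> \<le> M"
  shows "integrable lborel (\<lambda>y. dx_kernel x y * h y)"
proof (rule Bochner_Integration.integrable_bound)
  show "integrable lborel (\<lambda>y. exp (- \<bar>x - y\<bar>) * M)"
    by (intro integrable_mult_left integrable_exp_minus_abs)
  have "\<bar>dx_kernel x y * h y\<bar> \<le> \<bar>exp (- \<bar>x - y\<bar>) * M\<bar>" for y
    unfolding abs_mult using abs_dx_kernel_le[of x y] assms(2)[of y]
    by (intro mult_mono) auto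
  then show "AE y in lborel. norm (dx_kernel x y * h y) \<le> norm (exp (- \<bar>x - y\<bar>) * M)"
    by simp
qed measurable

lemma exp_diff_le:
  fixes p q :: real
  assumes "p \<le> q"
  shows "exp (- p) - exp (- q) \<le> (q - p) * exp (- p)"
proof -
  have "exp (- p) * (1 + (p - q)) \<le> exp (- p) * exp (p - q)"
    by (intro mult_left_mono exp_ge_add_one_self) auto
  also have "\<dots> = exp (- q)"
    by (simp flip: exp_add)
  finally show ?thesis
    by (simp add: algebra_simps)
qed

text \<open>Away from its jump the kernel is Lipschitz in \<open>x\<close>, with an exponentially
  decaying constant. Only the points \<open>y\<close> between \<open>x\<close> and \<open>x'\<close>
  see the jump, of height 1; the indicator pays for them, and its integral is again
  \<open>x' - x\<close>.\<close>

lemma dx_kernel_diff_le: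
  assumes "x \<le> x'"
  shows "\<bar>dx_kernel x y - dx_kernel x' y\<bar> \<le>
    (x' - x) * (exp (- \<bar>x - y\<bar>) + exp (- \<bar>x' - y\<bar>)) + indicator {x..x'} y"
proof -
  consider "y < x" | "x' < y" | "y \<in> {x..x'}" by force
  then show ?thesis
  proof cases
    case 1
    then have "\<bar>dx_kernel x y - dx_kernel x' y\<bar> = (exp (- (x - y)) - exp (- (x' - y))) / 2"
      using assms by (simp add: dx_kernel_def sgn_if field_simps)
    also have "\<dots> \<le> (x' - x) * exp (- (x - y))"
      using exp_diff_le[of "x - y" "x' - y"] exp_le_cancel_iff[of "- (x' - y)" "- (x - y)"] assms by argo
    also have "\<dots> \<le> (x' - x) * (exp (- \<bar>x - y\<bar>) + exp (- \<bar>x' - y\<bar>))"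
      using assms 1 by (intro mult_left_mono) auto
    finally show ?thesis
      by (rule order_trans) (simp add: indicator_def)
  next
    case 2
    then have "\<bar>dx_kernel x y - dx_kernel x' y\<bar> = (exp (- (y - x')) - exp (- (y - x))) / 2"
      using assms by (simp add: dx_kernel_def sgn_if field_simps)
    also have "\<dots> \<le> (x' - x) * exp (- (y - x'))"
      using exp_diff_le[of "y - x'" "y - x"] exp_le_cancel_iff[of "- (y - x)" "- (y - x')"] assms by argo
    also have "\<dots> \<le> (x' - x) * (exp (- \<bar>x - y\<bar>) + exp (- \<bar>x' - y\<bar>))"
      using assms 2 by (intro mult_left_mono) auto
    finally show ?thesis
      by (rule order_trans) (simp add: indicator_def)
  next
    case 3
    have half: "\<bar>dx_kernel z y\<bar> \<le> 1 / 2" for z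
      by (auto simp: dx_kernel_def sgn_if)
    have "\<bar>dx_kernel x y - dx_kernel x' y\<bar> \<le> 0 + 1"
      using half[of x] half[of x'] by linarith
    also have "\<dots> \<le> (x' - x) * (exp (- \<bar>x - y\<bar>) + exp (- \<bar>x' - y\<bar>)) + indicator {x..x'} y"
      using 3 assms by (intro add_mono mult_nonneg_nonneg) auto
    finally show ?thesis .
  qed
qed

lemma dx_inv_helmholtz_bound:
  assumes [measurable]: "h \<in> borel_measurable borel" and h: "\<And>y. \<bar>h y\<bar> \<le> M"
  shows "\<bar>dx_inv_helmholtz h x\<bar> \<le> M * (LINT y|lborel. exp (- \<bar>y\<bar>))"
proof -
  have "\<bar>LINT y|lborel. dx_kernel x y * h y\<bar> \<le> (LINT y|lborel. exp (- \<bar>x - y\<bar>) * M)"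
  proof (rule integral_abs_bound_integral)
    show "\<bar>dx_kernel x y * h y\<bar> \<le> exp (- \<bar>x - y\<bar>) * M" for y
      unfolding abs_mult using abs_dx_kernel_le[of x y] h[of y] by (intro mult_mono) auto
  qed (use integrable_dx_kernel_mult[OF assms] integrable_exp_minus_abs in auto)
  then show ?thesis
    by (simp add: dx_inv_helmholtz_eq integral_exp_minus_abs_translate mult.commute)
qed

text \<open>Integrating the kernel estimate, each of the two exponentials contributes the full mass
  of \<open>exp (- \<bar>y\<bar>)\<close>, and the jump contributes the 1. The operator thus gains a
  derivative from boundedness of the density, and the constant is proportional to
  \<open>M\<close>.\<close>

lemma dx_inv_helmholtz_lipschitz:
  assumes [measurable]: "h \<in> borel_measurable borel" and h: "\<And>y. \<bar>h y\<bar> \<le> M"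
  shows "\<bar>dx_inv_helmholtz h x - dx_inv_helmholtz h x'\<bar>
    \<le> M * (2 * (LINT y|lborel. exp (- \<bar>y\<bar>)) + 1) * \<bar>x - x'\<bar>"
proof -
  have *: "\<bar>dx_inv_helmholtz h x - dx_inv_helmholtz h x'\<bar>
    \<le> M * (2 * (LINT y|lborel. exp (- \<bar>y\<bar>)) + 1) * (x' - x)" if "x \<le> x'" for x x'
  proof -
    let ?b = "\<lambda>y. (x' - x) * (exp (- \<bar>x - y\<bar>) + exp (- \<bar>x' - y\<bar>)) + indicator {x..x'} y"
    have b: "integrable lborel ?b"
      by (intro Bochner_Integration.integrable_add integrable_mult_right integrable_exp_minus_abs
          integrable_real_indicator) (auto simp: that)
    have "dx_inv_helmholtz h x - dx_inv_helmholtz h x'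
        = (LINT y|lborel. (dx_kernel x y - dx_kernel x' y) * h y)"
      unfolding dx_inv_helmholtz_eq left_diff_distrib
      by (intro Bochner_Integration.integral_diff[symmetric] integrable_dx_kernel_mult[OF assms])
    also have "\<bar>\<dots>\<bar> \<le> (LINT y|lborel. ?b y * M)"
    proof (rule integral_abs_bound_integral)
      show "integrable lborel (\<lambda>y. (dx_kernel x y - dx_kernel x' y) * h y)"
        unfolding left_diff_distrib by (intro Bochner_Integration.integrable_diff integrable_dx_kernel_mult[OF assms])
      show "\<bar>(dx_kernel x y - dx_kernel x' y) * h y\<bar> \<le> ?b y * M" for y
        unfolding abs_mult using dx_kernel_diff_le[OF that, of y] h[of y]
        by (intro mult_mono) auto
    qed (use b in auto)
    also have "\<dots> = (LINT y|lborel. ?b y) * M" by simp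
    also have "(LINT y|lborel. ?b y) = (x' - x) * (2 * (LINT y|lborel. exp (- \<bar>y\<bar>))) + (x' - x)"
      using integrable_exp_minus_abs that
      by (subst Bochner_Integration.integral_add) (auto simp: integral_exp_minus_abs_translate)
    finally show ?thesis by (simp add: algebra_simps)
  qed
  show ?thesis
    using *[of x x'] *[of x' x] by (cases "x \<le> x'") (auto simp: abs_minus_commute)
qed

text \<open>For \<open>x < x'\<close> the kernel \<open>\<lambda>x. dx_kernel x y\<close> increases from \<open>x\<close> to \<open>x'\<close> strictly, unless
  \<open>y\<close> lies in between, so that equal values at \<open>x\<close> and \<open>x'\<close> force the density to vanish.\<close>

lemma AE_zero_if_dx_inv_helmholtz_const:
  assumes meas [measurable]: "h \<in> borel_measurable borel" and h: "\<And>y. \<bar>h y\<bar> \<le> M"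
    and nonneg: "\<And>y. 0 \<le> h y" and x: "x < x'" and zero: "\<And>y. y \<in> {x..x'} \<Longrightarrow> h y = 0"
    and eq: "dx_inv_helmholtz h x = dx_inv_helmholtz h x'"
  shows "AE y in lborel. h y = 0"
proof -
  let ?k = "\<lambda>y. dx_kernel x' y - dx_kernel x y"
  have k: "0 < ?k y" if "y \<notin> {x..x'}" for y
    using that x by (auto simp: dx_kernel_def sgn_if not_le)
  have int: "integrable lborel (\<lambda>y. ?k y * h y)"
    unfolding left_diff_distrib by (intro Bochner_Integration.integrable_diff integrable_dx_kernel_mult[OF meas h])
  have "(LINT y|lborel. ?k y * h y) = 0"
    using eq unfolding dx_inv_helmholtz_eq left_diff_distrib
    by (subst Bochner_Integration.integral_diff) (auto intro!: integrable_dx_kernel_mult[OF meas h])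
  \<comment> \<open>On the interval itself the jump makes \<open>?k\<close> negative; there the
    product has no wrong sign because \<open>h\<close> vanishes.\<close>
  moreover have "0 \<le> ?k y * h y" for y
    using k[of y] zero[of y] nonneg[of y] by (cases "y \<in> {x..x'}") auto
  ultimately have "AE y in lborel. ?k y * h y = 0"
    using int by (subst (asm) integral_nonneg_eq_0_iff_AE) auto
  then show ?thesis
  proof eventually_elim
    case (elim y)
    then show ?case using k[of y] zero[of y] by (cases "y \<in> {x..x'}") auto
  qed
qed

section \<open>Fourier inversion and the Sobolev embedding\<close>

text \<open>Comparison with a power of \<open>1 + \<bar>\<xi>\<bar>\<close>, whose antiderivative is
  explicit and tends to 0 exactly when \<open>2 * r + 1\<close> is negative. As \<open>r\<close> is
  negative too, the upper bound on \<open>(1 + \<bar>\<xi>\<bar>)\<^sup>2\<close> becomes an upper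
  bound on the power.\<close>

lemma integrable_one_plus_square_powr:
  assumes "r < - 1 / 2"
  shows "integrable lborel (\<lambda>\<xi>::real. (1 + \<xi>\<^sup>2) powr r)"
proof (rule Bochner_Integration.integrable_bound)
  have "((\<lambda>x::real. (1 + x) powr (2 * r + 1) / (2 * r + 1)) \<longlongrightarrow> 0) at_top"
    using assms by real_asymp
  then show "integrable lborel (\<lambda>x. 2 powr (- r) * (1 + \<bar>x\<bar>) powr (2 * r))"
    using assms
    by (intro integrable_mult_right integrable_comp_abs[where f = "\<lambda>x. (1 + x) powr (2 * r)"
          and F = "\<lambda>x. (1 + x) powr (2 * r + 1) / (2 * r + 1)"])
      (auto intro!: derivative_eq_intros)
  have "(1 + \<xi>\<^sup>2) powr r \<le> 2 powr (- r) * (1 + \<bar>\<xi>\<bar>) powr (2 * r)" for \<xi> :: real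
  proof -
    have "(1 + \<bar>\<xi>\<bar>)\<^sup>2 \<le> 2 * (1 + \<xi>\<^sup>2)"
      using zero_le_power2[of "1 - \<bar>\<xi>\<bar>"] by (simp add: power2_eq_square algebra_simps)
    then have "(1 + \<xi>\<^sup>2) powr r \<le> ((1 + \<bar>\<xi>\<bar>)\<^sup>2 / 2) powr r"
      using assms by (intro powr_mono2') auto
    also have "\<dots> = 2 powr (- r) * (1 + \<bar>\<xi>\<bar>) powr (2 * r)"
      by (simp add: powr_divide powr_minus_divide powr_powr flip: powr_numeral)
    finally show ?thesis .
  qed
  then show "AE \<xi> in lborel. norm ((1 + \<xi>\<^sup>2) powr r) \<le> norm (2 powr (- r) * (1 + \<bar>\<xi>\<bar>) powr (2 * r))"
    by simp
qed measurable

text \<open>Young's inequality, with the weight split as \<open>p powr (- s / 2)\<close> times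
  \<open>p powr (s / 2)\<close>. In place of the product in Cauchy-Schwarz it yields a sum, so the
  resulting embedding bound is not homogeneous in the norm; that is enough for a uniform
  bound.\<close>

lemma one_plus_abs_mult_le:
  fixes \<xi> y s :: real
  assumes "0 \<le> y"
  shows "(1 + \<bar>\<xi>\<bar>) * y \<le> (1 + \<xi>\<^sup>2) powr s * y\<^sup>2 / 2 + (1 + \<xi>\<^sup>2) powr (1 - s)"
proof -
  define p where "p = 1 + \<xi>\<^sup>2"
  have p: "p > 0" by (simp add: p_def add_pos_nonneg)
  have "2 * ((1 + \<bar>\<xi>\<bar>) * p powr (- s / 2)) * (p powr (s / 2) * y)
      \<le> ((1 + \<bar>\<xi>\<bar>) * p powr (- s / 2))\<^sup>2 + (p powr (s / 2) * y)\<^sup>2"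
    by (rule sum_squares_bound)
  also have "2 * ((1 + \<bar>\<xi>\<bar>) * p powr (- s / 2)) * (p powr (s / 2) * y) = 2 * ((1 + \<bar>\<xi>\<bar>) * y)"
    using p by (simp add: powr_minus field_simps)
  also have "(p powr (s / 2) * y)\<^sup>2 = p powr s * y\<^sup>2"
    by (simp add: power_mult_distrib power2_eq_square flip: powr_add)
  also have "((1 + \<bar>\<xi>\<bar>) * p powr (- s / 2))\<^sup>2 = (1 + \<bar>\<xi>\<bar>)\<^sup>2 * p powr (- s)"
    by (simp add: power_mult_distrib power2_eq_square flip: powr_add)
  also have "\<dots> \<le> (2 * p) * p powr (- s)"
    using zero_le_power2[of "1 - \<bar>\<xi>\<bar>"]
    by (intro mult_right_mono) (simp_all add: p_def power2_eq_square algebra_simps)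
  also have "\<dots> = 2 * p powr (1 - s)"
    using p powr_add[of p 1 "- s"] by simp
  finally show ?thesis
    unfolding p_def by linarith
qed

text \<open>The condition \<open>s > 3 / 2\<close> enters as \<open>1 - s < - 1 / 2\<close>, which
  makes the last weight integrable. The factor \<open>1 + \<bar>\<xi>\<bar>\<close> on the left
  covers a function and its first derivative simultaneously.\<close>

lemma integrable_one_plus_abs_mult_norm:
  fixes F :: "real \<Rightarrow> complex"
  assumes [measurable]: "F \<in> borel_measurable lborel" and s: "s > 3 / 2"
    and int: "integrable lborel (\<lambda>\<xi>. (1 + \<xi>\<^sup>2) powr s * (norm (F \<xi>))\<^sup>2)"
  shows "integrable lborel (\<lambda>\<xi>. (1 + \<bar>\<xi>\<bar>) * norm (F \<xi>))" (is ?int)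
    and "(LINT \<xi>|lborel. (1 + \<bar>\<xi>\<bar>) * norm (F \<xi>))
      \<le> (LINT \<xi>|lborel. (1 + \<xi>\<^sup>2) powr s * (norm (F \<xi>))\<^sup>2) / 2
        + (LINT \<xi>|lborel. (1 + \<xi>\<^sup>2) powr (1 - s))" (is "_ \<le> ?rhs")
proof -
  let ?b = "\<lambda>\<xi>. (1 + \<xi>\<^sup>2) powr s * (norm (F \<xi>))\<^sup>2 / 2 + (1 + \<xi>\<^sup>2) powr (1 - s)"
  have w: "integrable lborel (\<lambda>\<xi>::real. (1 + \<xi>\<^sup>2) powr (1 - s))"
    by (rule integrable_one_plus_square_powr) (use s in auto)
  have b: "integrable lborel ?b"
    using int w by (intro Bochner_Integration.integrable_add) auto
  have le: "(1 + \<bar>\<xi>\<bar>) * norm (F \<xi>) \<le> ?b \<xi>" for \<xi>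
    by (rule one_plus_abs_mult_le) simp
  show int': ?int
    using b by (rule Bochner_Integration.integrable_bound) (use le in \<open>auto intro: order_trans\<close>)
  have "(LINT \<xi>|lborel. (1 + \<bar>\<xi>\<bar>) * norm (F \<xi>)) \<le> (LINT \<xi>|lborel. ?b \<xi>)"
    using int' b le by (intro integral_mono) auto
  also have "\<dots> = ?rhs"
    using int w by (subst Bochner_Integration.integral_add) auto
  finally show "(LINT \<xi>|lborel. (1 + \<bar>\<xi>\<bar>) * norm (F \<xi>)) \<le> ?rhs" .
qed

text \<open>The mean value inequality turns the bound on \<open>g'\<close> into the same bound for
  all difference quotients, so dominated convergence applies along every sequence tending to
  \<open>x\<close>.\<close>

lemma DERIV_integral_dominated:
  fixes g g' :: "real \<Rightarrow> 'a \<Rightarrow> real"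
  assumes int: "\<And>x. integrable M (g x)"
    and D: "\<And>x \<xi>. ((\<lambda>x. g x \<xi>) has_real_derivative g' x \<xi>) (at x)"
    and [measurable]: "g' x \<in> borel_measurable M"
    and bound: "\<And>x \<xi>. \<bar>g' x \<xi>\<bar> \<le> b \<xi>" and b: "integrable M b"
  shows "((\<lambda>x. LINT \<xi>|M. g x \<xi>) has_real_derivative (LINT \<xi>|M. g' x \<xi>)) (at x)"
  unfolding has_field_derivative_iff tendsto_at_iff_sequentially
proof (intro allI impI)
  fix X :: "nat \<Rightarrow> real"
  assume "\<forall>i. X i \<in> UNIV - {x}" and X: "X \<longlonglongrightarrow> x"
  then have ne: "X i \<noteq> x" for i by auto
  have [measurable]: "g y \<in> borel_measurable M" for y
    using int by auto
  have "(\<lambda>i. LINT \<xi>|M. (g (X i) \<xi> - g x \<xi>) / (X i - x)) \<longlonglongrightarrow> (LINT \<xi>|M. g' x \<xi>)"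
  proof (rule integral_dominated_convergence[OF _ _ b])
    show "AE \<xi> in M. (\<lambda>i. (g (X i) \<xi> - g x \<xi>) / (X i - x)) \<longlonglongrightarrow> g' x \<xi>"
    proof (rule AE_I2)
      fix \<xi>
      show "(\<lambda>i. (g (X i) \<xi> - g x \<xi>) / (X i - x)) \<longlonglongrightarrow> g' x \<xi>"
        using D[of \<xi> x] X ne unfolding has_field_derivative_iff tendsto_at_iff_sequentially comp_def
        by blast
    qed
    show "AE \<xi> in M. norm ((g (X i) \<xi> - g x \<xi>) / (X i - x)) \<le> b \<xi>" for i
    proof (rule AE_I2)
      fix \<xi>
      have "norm (g (X i) \<xi> - g x \<xi>) \<le> b \<xi> * norm (X i - x)"
        by (rule field_differentiable_bound[where S = UNIV and f = "\<lambda>x. g x \<xi>"]) (use D bound in auto)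
      then show "norm ((g (X i) \<xi> - g x \<xi>) / (X i - x)) \<le> b \<xi>"
        using ne[of i] by (simp add: divide_le_eq abs_divide)
    qed
  qed measurable
  then show "((\<lambda>y. ((LINT \<xi>|M. g y \<xi>) - (LINT \<xi>|M. g x \<xi>)) / (y - x)) \<circ> X)
      \<longlonglongrightarrow> (LINT \<xi>|M. g' x \<xi>)"
    by (simp add: comp_def Bochner_Integration.integral_diff[OF int int])
qed

text \<open>Differentiation brings down a factor \<open>\<xi>\<close>, and both 1 and
  \<open>\<bar>\<xi>\<bar>\<close> are at most \<open>1 + \<bar>\<xi>\<bar>\<close>; hence a single
  constant for value and derivative. Taking real parts keeps the calculus real.\<close>

lemma DERIV_Re_inverse_fourier:
  fixes F :: "real \<Rightarrow> complex"
  assumes [measurable]: "F \<in> borel_measurable lborel"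
    and int: "integrable lborel (\<lambda>\<xi>. (1 + \<bar>\<xi>\<bar>) * norm (F \<xi>))"
  defines "I \<equiv> LINT \<xi>|lborel. (1 + \<bar>\<xi>\<bar>) * norm (F \<xi>)"
  obtains D where "\<And>x. ((\<lambda>x. Re (LINT \<xi>|lborel. F \<xi> * cis (x * \<xi>))) has_real_derivative D x) (at x)"
    and "\<And>x. \<bar>D x\<bar> \<le> I" and "\<And>x. \<bar>Re (LINT \<xi>|lborel. F \<xi> * cis (x * \<xi>))\<bar> \<le> I"
proof -
  define g where "g x \<xi> = Re (F \<xi> * cis (x * \<xi>))" for x \<xi>
  define g' where "g' x \<xi> = Re (F \<xi> * (\<i> * \<xi> * cis (x * \<xi>)))" for x \<xi>
  have [measurable]: "(\<lambda>\<xi>. cis (x * \<xi>)) \<in> borel_measurable borel" for x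
    by (intro borel_measurable_continuous_onI continuous_intros)
  have [measurable]: "g x \<in> borel_measurable borel" "g' x \<in> borel_measurable borel" for x
    using assms(1) unfolding g_def g'_def by measurable
  have le1: "norm (F \<xi> * cis (x * \<xi>)) \<le> (1 + \<bar>\<xi>\<bar>) * norm (F \<xi>)" for x \<xi>
    by (simp add: norm_mult mult_le_cancel_right1)
  have intF: "integrable lborel (\<lambda>\<xi>. F \<xi> * cis (x * \<xi>))" for x
    using int by (rule Bochner_Integration.integrable_bound) (use le1 in \<open>auto intro: order_trans\<close>)
  have intg: "integrable lborel (g x)" for x
    unfolding g_def by (intro integrable_Re intF)
  have Re: "Re (LINT \<xi>|lborel. F \<xi> * cis (x * \<xi>)) = (LINT \<xi>|lborel. g x \<xi>)" for x
    unfolding g_def by (intro integral_Re[symmetric] intF)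
  have bnd: "\<bar>g x \<xi>\<bar> \<le> (1 + \<bar>\<xi>\<bar>) * norm (F \<xi>)" for x \<xi>
    unfolding g_def by (rule order_trans[OF abs_Re_le_cmod le1])
  have bnd': "\<bar>g' x \<xi>\<bar> \<le> (1 + \<bar>\<xi>\<bar>) * norm (F \<xi>)" for x \<xi>
    unfolding g'_def
    by (rule order_trans[OF abs_Re_le_cmod]) (simp add: norm_mult algebra_simps)
  have intg': "integrable lborel (g' x)" for x
    using int by (rule Bochner_Integration.integrable_bound) (use bnd' in \<open>auto intro: order_trans\<close>)
  have "((\<lambda>x. g x \<xi>) has_real_derivative g' x \<xi>) (at x)" for x \<xi>
    unfolding g_def g'_def by (auto intro!: derivative_eq_intros simp: algebra_simps)
  then have "((\<lambda>x. LINT \<xi>|lborel. g x \<xi>) has_real_derivative (LINT \<xi>|lborel. g' x \<xi>)) (at x)" for x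
    by (intro DERIV_integral_dominated[OF intg _ _ bnd' int]) auto
  moreover have "\<bar>LINT \<xi>|lborel. g' x \<xi>\<bar> \<le> I" for x
    unfolding I_def by (intro integral_abs_bound_integral intg' int bnd')
  moreover have "\<bar>LINT \<xi>|lborel. g x \<xi>\<bar> \<le> I" for x
    unfolding I_def by (intro integral_abs_bound_integral intg int bnd)
  ultimately show ?thesis
    by (intro that[of "\<lambda>x. LINT \<xi>|lborel. g' x \<xi>"]) (auto simp: Re)
qed

section \<open>Gaussian test functions and inversion of the L2 Fourier transform\<close>

lemma borel_measurable_cis [measurable]: "cis \<in> borel_measurable borel"
  by (intro borel_measurable_continuous_onI continuous_intros)

text \<open>The Gaussian is its own Fourier transform; scaled and translated, it serves as an
  approximate identity whose Fourier representation is explicit.\<close>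

lemma gaussian_fourier:
  fixes c x n :: real
  assumes "n > 0"
  shows "complex_of_real (n * std_normal_density (n * (x - c))) =
    1 / sqrt (2 * pi) * (LINT \<xi>|lborel. std_normal_density (\<xi> / n) * cis (c * \<xi>) * cis (- (x * \<xi>)))"
proof -
  have "complex_of_real (exp (- (n * (x - c))\<^sup>2 / 2)) = (CLINT z|std_normal_distribution. iexp (n * (x - c) * z))"
    using fun_cong[OF char_std_normal_distribution, of "n * (x - c)"] by (simp add: char_def)
  also have "\<dots> = (LINT z|lborel. std_normal_density z *\<^sub>R iexp (n * (x - c) * z))"
    by (subst integral_density) auto
  also have "\<dots> = (LINT z|lborel. std_normal_density z * cis (n * (x - c) * z))"
    by (simp add: scaleR_conv_of_real cis_conv_exp)
  \<comment> \<open>The substitution \<open>z = - \<xi> / n\<close>: its sign is chosen to produce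
    the phase \<open>cis (- (x * \<xi>))\<close> of \<open>truncated_fourier\<close>.\<close>
  also have "\<dots> = \<bar>- 1 / n\<bar> *\<^sub>R (LINT \<xi>|lborel. std_normal_density (0 + (- 1 / n) * \<xi>) *
      cis (n * (x - c) * (0 + (- 1 / n) * \<xi>)))"
    using assms by (intro lborel_integral_real_affine) auto
  also have "\<dots> = (1 / n) * (LINT \<xi>|lborel. std_normal_density (\<xi> / n) * cis (c * \<xi>) * cis (- (x * \<xi>)))"
    using assms
    by (auto simp: scaleR_conv_of_real cis_mult mult.assoc std_normal_density_def right_diff_distrib
        mult.commute intro!: Bochner_Integration.integral_cong)
  finally show ?thesis
    using assms by (simp add: std_normal_density_def field_simps)
qed

text \<open>Fubini moves the transform from the Gaussian to \<open>h\<close>. It is applied before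
  the cutoff is removed because a square integrable function need not be integrable on the whole
  line.\<close>

lemma truncated_gaussian_pairing:
  fixes h :: "real \<Rightarrow> complex"
  assumes [measurable]: "h \<in> borel_measurable borel" and int: "set_integrable lborel {-R..R} h"
    and n: "n > 0"
  shows "(LINT x:{-R..R}|lborel. h x * (n * std_normal_density (n * (x - c)))) =
    (LINT \<xi>|lborel. std_normal_density (\<xi> / n) * cis (c * \<xi>) * truncated_fourier h R \<xi>)"
proof -
  let ?w = "\<lambda>\<xi>. std_normal_density (\<xi> / n) * cis (c * \<xi>)"
  let ?h = "\<lambda>x. indicator {-R..R} x *\<^sub>R h x"
  let ?f = "\<lambda>x \<xi>. ?h x * (?w \<xi> * cis (- (x * \<xi>)))"
  have w: "integrable lborel (\<lambda>\<xi>. std_normal_density (\<xi> / n))"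
    using lborel_integrable_real_affine[OF integrable_normal_density[of 1 0], of "1 / n" 0] n by simp
  have h: "integrable lborel ?h"
    using int by (simp add: set_integrable_def)
  have wc: "integrable lborel (\<lambda>\<xi>. ?w \<xi> * cis (- (x * \<xi>)))" for x
    using w by (rule Bochner_Integration.integrable_bound) (auto simp: norm_mult)
  have "integrable (lborel \<Otimes>\<^sub>M lborel) (case_prod ?f)"
  proof (rule lborel_pair.Fubini_integrable)
    show "integrable lborel (\<lambda>x. LINT y|lborel. norm (case (x, y) of (x, \<xi>) \<Rightarrow> ?f x \<xi>))"
      using h[THEN integrable_norm] by (simp add: norm_mult flip: mult.assoc)
    show "AE x in lborel. integrable lborel (\<lambda>y. case (x, y) of (x, \<xi>) \<Rightarrow> ?f x \<xi>)"
      using wc by (intro AE_I2) auto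
  qed measurable
  then have Fub: "(LINT \<xi>|lborel. LINT x|lborel. ?f x \<xi>) = (LINT x|lborel. LINT \<xi>|lborel. ?f x \<xi>)"
    by (rule lborel_pair.Fubini_integral)
  have "(LINT x:{-R..R}|lborel. h x * (n * std_normal_density (n * (x - c)))) =
      (LINT x|lborel. ?h x * (1 / sqrt (2 * pi) * (LINT \<xi>|lborel. ?w \<xi> * cis (- (x * \<xi>)))))"
    unfolding set_lebesgue_integral_def gaussian_fourier[OF n]
    by (intro Bochner_Integration.integral_cong) (auto simp: scaleR_conv_of_real)
  also have "\<dots> = (LINT x|lborel. 1 / sqrt (2 * pi) * (LINT \<xi>|lborel. ?f x \<xi>))"
    by (simp only: integral_mult_right_zero mult.left_commute)
  also have "\<dots> = (LINT \<xi>|lborel. 1 / sqrt (2 * pi) * (LINT x|lborel. ?f x \<xi>))"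
    by (simp only: integral_mult_right_zero Fub)
  also have "\<dots> = (LINT \<xi>|lborel. ?w \<xi> * truncated_fourier h R \<xi>)"
  proof (rule Bochner_Integration.integral_cong[OF refl])
    fix \<xi>
    have "(LINT x|lborel. ?f x \<xi>) = (LINT x|lborel. ?w \<xi> * (indicator {-R..R} x *\<^sub>R (h x * cis (- (x * \<xi>)))))"
      by (intro Bochner_Integration.integral_cong) (auto simp: mult.left_commute mult.commute)
    also have "\<dots> = ?w \<xi> * (LINT x:{-R..R}|lborel. h x * cis (- (x * \<xi>)))"
      unfolding set_lebesgue_integral_def by (rule integral_mult_right_zero)
    finally show "1 / sqrt (2 * pi) * (LINT x|lborel. ?f x \<xi>) = ?w \<xi> * truncated_fourier h R \<xi>"
      by (simp add: truncated_fourier_def mult.left_commute)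
  qed
  finally show ?thesis .
qed

lemma square_integrable_mult:
  fixes f g :: "real \<Rightarrow> complex"
  assumes "square_integrable f" "square_integrable g"
  shows "integrable lborel (\<lambda>x. f x * g x)"
proof (rule Bochner_Integration.integrable_bound)
  show "integrable lborel (\<lambda>x. (norm (f x))\<^sup>2 + (norm (g x))\<^sup>2)"
    using assms by (auto simp: square_integrable_def)
  show "(\<lambda>x. f x * g x) \<in> borel_measurable lborel"
    using assms by (auto simp: square_integrable_def)
  have "norm (f x * g x) \<le> (norm (f x))\<^sup>2 + (norm (g x))\<^sup>2" for x
    using sum_squares_bound[of "norm (f x)" "norm (g x)"]
      mult_nonneg_nonneg[OF norm_ge_zero norm_ge_zero, of "f x" "g x"]
    unfolding norm_mult by linarith
  then show "AE x in lborel. norm (f x * g x) \<le> norm ((norm (f x))\<^sup>2 + (norm (g x))\<^sup>2)"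
    by simp
qed

lemma square_integrable_imp_set_integrable:
  fixes f :: "real \<Rightarrow> complex"
  assumes "square_integrable f"
  shows "set_integrable lborel {a..b} f"
proof -
  have "square_integrable (\<lambda>x. complex_of_real (indicator {a..b} x))"
    by (auto simp: square_integrable_def power2_eq_square integrable_indicator_iff
        emeasure_lborel_Icc_eq simp flip: indicator_inter_arith)
  from square_integrable_mult[OF this assms] show ?thesis
    by (simp add: set_integrable_def scaleR_conv_of_real)
qed

lemma truncated_fourier_measurable:
  fixes h :: "real \<Rightarrow> complex"
  assumes h: "square_integrable h"
  shows "truncated_fourier h R \<in> borel_measurable borel"
proof -
  have [measurable]: "h \<in> borel_measurable borel"
    using h by (simp add: square_integrable_def)
  show ?thesis
    unfolding truncated_fourier_def set_lebesgue_integral_def by measurable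
qed

text \<open>Cauchy-Schwarz with \<open>\<integral>\<^sup>+\<close>, so that the difference need not be known to be square integrable.\<close>

lemma tendsto_integral_mult_L2:
  fixes w F :: "real \<Rightarrow> complex" and G :: "'b \<Rightarrow> real \<Rightarrow> complex"
  assumes w: "square_integrable w" and [measurable]: "F \<in> borel_measurable borel" "\<And>R. G R \<in> borel_measurable borel"
    and lim: "((\<lambda>R. \<integral>\<^sup>+\<xi>. ennreal ((norm (F \<xi> - G R \<xi>))\<^sup>2) \<partial>lborel) \<longlongrightarrow> 0) net"
    and intF: "integrable lborel (\<lambda>\<xi>. w \<xi> * F \<xi>)"
  shows "((\<lambda>R. LINT \<xi>|lborel. w \<xi> * G R \<xi>) \<longlongrightarrow> (LINT \<xi>|lborel. w \<xi> * F \<xi>)) net"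
proof -
  have [measurable]: "w \<in> borel_measurable borel"
    using w by (simp add: square_integrable_def)
  define A where "A = (\<integral>\<^sup>+\<xi>. ennreal ((norm (w \<xi>))\<^sup>2) \<partial>lborel)"
  have A: "A \<noteq> \<infinity>"
    using w unfolding A_def by (subst nn_integral_eq_integral) (auto simp: square_integrable_def)
  let ?d = "\<lambda>R. (LINT \<xi>|lborel. w \<xi> * F \<xi>) - (LINT \<xi>|lborel. w \<xi> * G R \<xi>)"
  let ?N = "\<lambda>R. \<integral>\<^sup>+\<xi>. ennreal ((norm (F \<xi> - G R \<xi>))\<^sup>2) \<partial>lborel"
  \<comment> \<open>At infinite distance \<open>w * G R\<close> could fail to be integrable, and its
    integral would then be 0 by default. The estimate is claimed for finite distances, and
    \<open>lim\<close> makes the distance finite eventually.\<close>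
  have le: "ennreal ((norm (?d R))\<^sup>2) \<le> A * ?N R" if fin: "?N R < \<infinity>" for R
  proof -
    have CS: "(\<integral>\<^sup>+\<xi>. ennreal (norm (w \<xi>)) * ennreal (norm (F \<xi> - G R \<xi>)) \<partial>lborel)\<^sup>2 \<le> A * ?N R"
      unfolding A_def
      using Cauchy_Schwarz_nn_integral[of "\<lambda>\<xi>. ennreal (norm (w \<xi>))" lborel "\<lambda>\<xi>. ennreal (norm (F \<xi> - G R \<xi>))"]
      by (simp add: ennreal_power)
    have "A * ?N R < \<infinity>"
      using A fin by (simp add: ennreal_mult_less_top less_top)
    then have "(\<integral>\<^sup>+\<xi>. ennreal (norm (w \<xi>)) * ennreal (norm (F \<xi> - G R \<xi>)) \<partial>lborel)\<^sup>2 < \<infinity>"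
      using CS by (rule le_less_trans[rotated])
    then have "(\<integral>\<^sup>+\<xi>. ennreal (norm (w \<xi> * (F \<xi> - G R \<xi>))) \<partial>lborel) < \<infinity>"
      by (simp add: norm_mult ennreal_mult power_less_top_ennreal)
    then have int: "integrable lborel (\<lambda>\<xi>. w \<xi> * (F \<xi> - G R \<xi>))"
      by (intro integrableI_bounded) auto
    have intG: "integrable lborel (\<lambda>\<xi>. w \<xi> * G R \<xi>)"
      using Bochner_Integration.integrable_diff[OF intF int] by (simp add: algebra_simps)
    have "?d R = (LINT \<xi>|lborel. w \<xi> * (F \<xi> - G R \<xi>))"
      using intF intG by (simp add: right_diff_distrib)
    then have "ennreal (norm (?d R)) \<le> (\<integral>\<^sup>+\<xi>. ennreal (norm (w \<xi>)) * ennreal (norm (F \<xi> - G R \<xi>)) \<partial>lborel)"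
      using integral_norm_bound_ennreal[OF int] by (simp add: norm_mult ennreal_mult)
    then have "(ennreal (norm (?d R)))\<^sup>2 \<le> (\<integral>\<^sup>+\<xi>. ennreal (norm (w \<xi>)) * ennreal (norm (F \<xi> - G R \<xi>)) \<partial>lborel)\<^sup>2"
      by (intro power_mono) auto
    also note CS
    finally show ?thesis by (simp add: ennreal_power)
  qed
  have "((\<lambda>R. A * ?N R) \<longlongrightarrow> A * 0) net"
    using A by (intro ennreal_tendsto_cmult lim) (auto simp: less_top)
  then have lim': "((\<lambda>R. A * ?N R) \<longlongrightarrow> 0) net" by simp
  have ev: "\<forall>\<^sub>F R in net. ?N R < \<infinity>"
    using lim by (rule order_tendstoD) simp
  have "((\<lambda>R. ennreal ((norm (?d R))\<^sup>2)) \<longlongrightarrow> ennreal 0) net"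
    unfolding ennreal_0
    by (rule tendsto_sandwich[OF _ _ tendsto_const lim']) (use ev le in \<open>auto elim: eventually_mono\<close>)
  then have "((\<lambda>R. (norm (?d R))\<^sup>2) \<longlongrightarrow> 0) net"
    by (rule tendsto_ennrealD) auto
  then have "((\<lambda>R. norm (?d R)) \<longlongrightarrow> 0) net"
    using tendsto_real_sqrt by fastforce
  then have "(?d \<longlongrightarrow> 0) net"
    by (rule tendsto_norm_zero_cancel)
  then have "((\<lambda>R. (LINT \<xi>|lborel. w \<xi> * F \<xi>) - ?d R) \<longlongrightarrow> (LINT \<xi>|lborel. w \<xi> * F \<xi>) - 0) net"
    by (intro tendsto_intros)
  then show ?thesis by simp
qed

text \<open>Half of the exponent absorbs the growing factor: \<open>n \<le> p\<close>, and
  \<open>p * exp (- (p\<^sup>2 / 4)) \<le> 1\<close>. The other half is still below a Gaussian that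
  does not depend on \<open>n\<close>.\<close>

lemma scaled_gaussian_le:
  assumes "1 \<le> n" "1 \<le> \<bar>y\<bar>"
  shows "n * std_normal_density (n * y) \<le> exp (- y\<^sup>2 / 4)"
proof -
  define p where "p = n * \<bar>y\<bar>"
  have np: "n \<le> p" and p: "0 \<le> p" and yp: "\<bar>y\<bar> \<le> p"
    using assms mult_left_mono[of 1 "\<bar>y\<bar>" n] mult_right_mono[of 1 n "\<bar>y\<bar>"] by (auto simp: p_def)
  have "n * std_normal_density (n * y) \<le> n * exp (- (p\<^sup>2 / 2))"
  proof -
    have "1 / sqrt (2 * pi) * exp (- (p\<^sup>2 / 2)) \<le> 1 * exp (- (p\<^sup>2 / 2))"
      using pi_ge_two by (intro mult_right_mono) auto
    then have "n * (1 / sqrt (2 * pi) * exp (- (p\<^sup>2 / 2))) \<le> n * (1 * exp (- (p\<^sup>2 / 2)))"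
      using assms(1) by (intro mult_left_mono) auto
    then show ?thesis
      by (simp add: std_normal_density_def p_def power_mult_distrib)
  qed
  also have "\<dots> \<le> p * exp (- (p\<^sup>2 / 2))"
    using np by (intro mult_right_mono) auto
  also have "\<dots> = p * exp (- (p\<^sup>2 / 4)) * exp (- (p\<^sup>2 / 4))"
    by (simp add: mult.assoc flip: exp_add)
  also have "\<dots> \<le> 1 * exp (- y\<^sup>2 / 4)"
  proof (intro mult_mono)
    have "p \<le> 1 + p\<^sup>2 / 4"
      using zero_le_power2[of "p / 2 - 1"] by (simp add: power2_eq_square algebra_simps)
    also have "\<dots> \<le> exp (p\<^sup>2 / 4)"
      by (rule exp_ge_add_one_self)
    finally show "p * exp (- (p\<^sup>2 / 4)) \<le> 1"
      by (simp add: exp_minus field_simps)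
    show "exp (- (p\<^sup>2 / 4)) \<le> exp (- y\<^sup>2 / 4)"
      using power_mono[OF yp, of 2] by simp
  qed auto
  finally show ?thesis by simp
qed

lemma integrable_mult_gaussian_translate:
  fixes h :: "real \<Rightarrow> complex"
  assumes "square_integrable h"
  shows "integrable lborel (\<lambda>x. norm (h x) * exp (- (x - c)\<^sup>2 / 4))"
proof -
  have eq: "(exp (- (x - c)\<^sup>2 / 4))\<^sup>2 = sqrt (2 * pi) * normal_density c 1 x" for x
    by (simp add: normal_density_def power2_eq_square flip: exp_add)
  have "square_integrable (\<lambda>x. complex_of_real (exp (- (x - c)\<^sup>2 / 4)))"
    unfolding square_integrable_def norm_of_real power2_abs eq by auto
  from integrable_norm[OF square_integrable_mult[OF assms this]] show ?thesis
    by (simp add: norm_mult)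
qed

lemma integrable_mult_scaled_gaussian:
  fixes h :: "real \<Rightarrow> complex"
  assumes h: "square_integrable h" and n: "n > 0"
  shows "integrable lborel (\<lambda>x. h x * (n * std_normal_density (n * (x - c))))"
proof -
  \<comment> \<open>Squaring a Gaussian rescales its argument by \<open>sqrt 2\<close>, so square
    integrability reduces to integrability of a normal density.\<close>
  have "integrable lborel (\<lambda>x. std_normal_density (- (n * sqrt 2) * c + n * sqrt 2 * x))"
    using n by (intro lborel_integrable_real_affine) auto
  moreover have "(n * std_normal_density (n * (x - c)))\<^sup>2 =
      n\<^sup>2 / sqrt (2 * pi) * std_normal_density (- (n * sqrt 2) * c + n * sqrt 2 * x)" for x
  proof -
    have "- (n * sqrt 2) * c + n * sqrt 2 * x = sqrt 2 * (n * (x - c))" by (simp add: algebra_simps)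
    then show ?thesis
      by (simp add: std_normal_density_def power_mult_distrib power_divide flip: exp_double)
  qed
  ultimately have "square_integrable (\<lambda>x. complex_of_real (n * std_normal_density (n * (x - c))))"
    by (simp add: square_integrable_def del: of_real_mult)
  from square_integrable_mult[OF h this] show ?thesis by simp
qed

text \<open>Near \<open>c\<close> the function is bounded, and away from \<open>c\<close> the scaled Gaussians are dominated by a
  fixed one: this takes the place of boundedness of \<open>h\<close>.\<close>

lemma gaussian_approximate_identity:
  fixes h :: "real \<Rightarrow> complex"
  assumes h: "square_integrable h" and cont: "continuous_on UNIV h"
  shows "(\<lambda>n. LINT x|lborel. h x * (real (Suc n) * std_normal_density (real (Suc n) * (x - c)))) \<longlonglongrightarrow> h c"
proof -
  have [measurable]: "h \<in> borel_measurable borel"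
    using h by (simp add: square_integrable_def)
  define k where "k n x = real (Suc n) * std_normal_density (real (Suc n) * (x - c))" for n x
  have k0: "0 \<le> k n x" for n x by (simp add: k_def)
  have [measurable]: "k n \<in> borel_measurable borel" for n unfolding k_def by measurable
  have int: "integrable lborel (\<lambda>x. h x * k n x)" for n
    unfolding k_def of_real_mult using integrable_mult_scaled_gaussian[OF h, of "real (Suc n)" c] by simp
  let ?I = "\<lambda>x. indicator {c - 1<..<c + 1} x :: complex"
  let ?J = "\<lambda>x. indicator (- {c - 1<..<c + 1}) x :: complex"
  have far: "(\<lambda>n. LINT x|lborel. ?J x * (h x * k n x)) \<longlonglongrightarrow> (LINT x|(lborel :: real measure). 0)"
  proof (rule integral_dominated_convergence[OF _ _ integrable_mult_gaussian_translate[OF h, of c]])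
    have dom: "norm (?J x * (h x * k n x)) \<le> norm (h x) * exp (- (x - c)\<^sup>2 / 4)" for x n
    proof (cases "x \<in> {c - 1<..<c + 1}")
      case False
      then have "k n x \<le> exp (- (x - c)\<^sup>2 / 4)"
        unfolding k_def by (intro scaled_gaussian_le) auto
      then show ?thesis
        using False k0[of n x] by (auto simp: norm_mult intro!: mult_left_mono)
    qed simp
    then show "AE x in lborel. norm (?J x * (h x * k n x)) \<le> norm (h x) * exp (- (x - c)\<^sup>2 / 4)" for n
      by simp
    have "(\<lambda>n. ?J x * (h x * k n x)) \<longlonglongrightarrow> 0" for x
    proof (cases "x \<in> {c - 1<..<c + 1}")
      case False
      then have "x - c \<noteq> 0" by auto
      then have "(x - c)\<^sup>2 > 0" by simp
      then have "(\<lambda>n. real (Suc n) * (1 / sqrt (2 * pi) * exp (- ((real (Suc n))\<^sup>2 * (x - c)\<^sup>2) / 2))) \<longlonglongrightarrow> 0"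
        by real_asymp
      then have "(\<lambda>n. k n x) \<longlonglongrightarrow> 0"
        unfolding k_def std_normal_density_def power_mult_distrib .
      then have "(\<lambda>n. ?J x * (h x * complex_of_real (k n x))) \<longlonglongrightarrow> ?J x * (h x * complex_of_real 0)"
        by (intro tendsto_intros)
      then show ?thesis by simp
    qed simp
    then show "AE x in lborel. (\<lambda>n. ?J x * (h x * k n x)) \<longlonglongrightarrow> 0" by simp
  qed measurable
  obtain B where B: "\<And>x. x \<in> {c - 1..c + 1} \<Longrightarrow> norm (h x) \<le> B"
  proof -
    have "compact (h ` {c - 1..c + 1})"
      using cont by (intro compact_continuous_image continuous_on_subset[OF cont]) auto
    then obtain B where "\<forall>y\<in>h ` {c - 1..c + 1}. norm y \<le> B"
      using compact_imp_bounded bounded_iff by metis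
    then show ?thesis using that by blast
  qed
  have B0: "B \<ge> 0" using order_trans[OF norm_ge_zero B[of c]] by simp
  \<comment> \<open>Substituting \<open>x = c + z / Suc n\<close> freezes the density; all
    dependence on \<open>n\<close> moves into the argument of \<open>h\<close> and the cutoff, where
    continuity at \<open>c\<close> gives the limit.\<close>
  have "(LINT x|lborel. ?I x * (h x * k n x)) =
      (LINT z|lborel. ?I (c + 1 / real (Suc n) * z) * h (c + 1 / real (Suc n) * z) * std_normal_density z)" for n
  proof -
    have "(LINT x|lborel. ?I x * (h x * k n x)) = \<bar>1 / real (Suc n)\<bar> *\<^sub>R
      (LINT z|lborel. ?I (c + 1 / real (Suc n) * z) * (h (c + 1 / real (Suc n) * z) * k n (c + 1 / real (Suc n) * z)))"
      by (rule lborel_integral_real_affine) simp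
    also have "\<dots> = (LINT z|lborel. \<bar>1 / real (Suc n)\<bar> *\<^sub>R
        (?I (c + 1 / real (Suc n) * z) * (h (c + 1 / real (Suc n) * z) * k n (c + 1 / real (Suc n) * z))))"
      by (rule integral_scaleR_right[symmetric])
    also have "\<dots> = (LINT z|lborel. ?I (c + 1 / real (Suc n) * z) * h (c + 1 / real (Suc n) * z) * std_normal_density z)"
      by (intro Bochner_Integration.integral_cong) (auto simp: k_def scaleR_conv_of_real field_simps simp del: of_nat_Suc)
    finally show ?thesis .
  qed
  moreover have "(\<lambda>n. LINT z|lborel. ?I (c + 1 / real (Suc n) * z) * h (c + 1 / real (Suc n) * z) * std_normal_density z)
      \<longlonglongrightarrow> (LINT z|lborel. h c * std_normal_density z)"
  proof (rule integral_dominated_convergence)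
    show "integrable lborel (\<lambda>z. B * std_normal_density z)" by simp
    have "norm (?I x * h x * std_normal_density z) \<le> B * std_normal_density z" for x z
      using B[of x] B0 by (auto simp: norm_mult indicator_def intro!: mult_right_mono)
    then show "AE z in lborel. norm (?I (c + 1 / real (Suc n) * z) * h (c + 1 / real (Suc n) * z) * std_normal_density z)
        \<le> B * std_normal_density z" for n by blast
    have "(\<lambda>n. ?I (c + 1 / real (Suc n) * z) * h (c + 1 / real (Suc n) * z) * std_normal_density z)
        \<longlonglongrightarrow> h c * std_normal_density z" for z
    proof -
      have lim: "(\<lambda>n. c + 1 / real (Suc n) * z) \<longlonglongrightarrow> c" by real_asymp
      then have ev: "\<forall>\<^sub>F n in sequentially. c + 1 / real (Suc n) * z \<in> {c - 1<..<c + 1}"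
        by (rule topological_tendstoD) auto
      have "(\<lambda>n. h (c + 1 / real (Suc n) * z)) \<longlonglongrightarrow> h c"
        using continuous_on_tendsto_compose[OF cont lim] by simp
      then have "(\<lambda>n. h (c + 1 / real (Suc n) * z) * std_normal_density z) \<longlonglongrightarrow> h c * std_normal_density z"
        by (intro tendsto_intros)
      then show ?thesis
        by (rule Lim_transform_eventually) (use ev in eventually_elim, simp)
    qed
    then show "AE z in lborel. (\<lambda>n. ?I (c + 1 / real (Suc n) * z) * h (c + 1 / real (Suc n) * z) * std_normal_density z)
        \<longlonglongrightarrow> h c * std_normal_density z" by blast
  qed measurable
  moreover have "(LINT z|lborel. h c * complex_of_real (std_normal_density z)) = h c"
    by (simp add: integral_complex_of_real)
  ultimately have near: "(\<lambda>n. LINT x|lborel. ?I x * (h x * k n x)) \<longlonglongrightarrow> h c"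
    by simp
  have "(LINT x|lborel. h x * k n x) = (LINT x|lborel. ?I x * (h x * k n x)) + (LINT x|lborel. ?J x * (h x * k n x))" for n
  proof -
    have i: "integrable lborel (\<lambda>x. ?I x * (h x * k n x))" "integrable lborel (\<lambda>x. ?J x * (h x * k n x))"
      by (rule Bochner_Integration.integrable_bound[OF int[of n]]; auto simp: indicator_def)+
    show ?thesis
      by (subst Bochner_Integration.integral_add[OF i, symmetric])
        (auto intro!: Bochner_Integration.integral_cong simp: indicator_def)
  qed
  then have "(\<lambda>n. LINT x|lborel. h x * k n x) \<longlonglongrightarrow> h c"
    using tendsto_add[OF near far] by simp
  then show ?thesis by (simp only: k_def)
qed

text \<open>The pairing of the truncation to \<open>[-R, R]\<close> has two limits, which must
  agree: by dominated convergence on the side of \<open>h\<close>, and by L2 convergence of the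
  truncated transforms on the side of \<open>F\<close>.\<close>

lemma fourier_L2_pairing:
  fixes h :: "real \<Rightarrow> complex"
  assumes F: "is_fourier_L2 h F" and n: "n > 0"
  shows "(LINT x|lborel. h x * (n * std_normal_density (n * (x - c)))) =
    (LINT \<xi>|lborel. std_normal_density (\<xi> / n) * cis (c * \<xi>) * F \<xi>)"
proof (rule tendsto_unique[OF trivial_limit_at_top_linorder])
  have h: "square_integrable h" and F2: "square_integrable F"
    using F by (auto simp: is_fourier_L2_def)
  have [measurable]: "h \<in> borel_measurable borel" "F \<in> borel_measurable borel"
    using h F2 by (simp_all add: square_integrable_def)
  let ?w = "\<lambda>\<xi>. std_normal_density (\<xi> / n) * cis (c * \<xi>)"
  let ?k = "\<lambda>x. n * std_normal_density (n * (x - c))"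
  have "integrable lborel (\<lambda>\<xi>. std_normal_density (0 + sqrt 2 / n * \<xi>))"
    using n by (intro lborel_integrable_real_affine) auto
  moreover have "(norm (?w \<xi>))\<^sup>2 = 1 / sqrt (2 * pi) * std_normal_density (0 + sqrt 2 / n * \<xi>)" for \<xi>
  proof -
    have "(norm (?w \<xi>))\<^sup>2 = (std_normal_density (\<xi> / n))\<^sup>2"
      by (simp only: norm_mult norm_cis norm_of_real power2_abs mult_1_right)
    also have "\<dots> = 1 / sqrt (2 * pi) * std_normal_density (0 + sqrt 2 / n * \<xi>)"
    proof -
      have "(exp (- (\<xi> / n)\<^sup>2 / 2))\<^sup>2 = exp (- (0 + sqrt 2 / n * \<xi>)\<^sup>2 / 2)"
        unfolding power2_eq_square[of "exp _"] exp_add[symmetric]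
        by (simp add: power_mult_distrib power_divide)
      then show ?thesis
        by (simp only: std_normal_density_def power_mult_distrib) (simp add: power_divide)
    qed
    finally show ?thesis .
  qed
  ultimately have w: "square_integrable ?w"
    by (simp add: square_integrable_def)
  have "((\<lambda>R. LINT \<xi>|lborel. ?w \<xi> * truncated_fourier h R \<xi>) \<longlongrightarrow> (LINT \<xi>|lborel. ?w \<xi> * F \<xi>)) at_top"
    using F truncated_fourier_measurable[OF h] w
    by (intro tendsto_integral_mult_L2) (auto simp: is_fourier_L2_def intro: square_integrable_mult[OF w F2])
  then show "((\<lambda>R. LINT x:{-R..R}|lborel. h x * ?k x) \<longlongrightarrow> (LINT \<xi>|lborel. ?w \<xi> * F \<xi>)) at_top"
    using truncated_gaussian_pairing[OF _ square_integrable_imp_set_integrable[OF h] n] by simp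
  have int: "integrable lborel (\<lambda>x. h x * ?k x)"
    by (rule integrable_mult_scaled_gaussian[OF h n])
  show "((\<lambda>R. LINT x:{-R..R}|lborel. h x * ?k x) \<longlongrightarrow> (LINT x|lborel. h x * ?k x)) at_top"
    unfolding set_lebesgue_integral_def
  proof (rule integral_dominated_convergence_at_top)
    show "integrable lborel (\<lambda>x. norm (h x * ?k x))"
      using int by (rule integrable_norm)
    show "\<forall>\<^sub>F R in at_top. AE x in lborel. norm (indicator {-R..R} x *\<^sub>R (h x * ?k x)) \<le> norm (h x * ?k x)"
      by (intro always_eventually allI AE_I2) (auto simp: indicator_def)
    show "AE x in lborel. ((\<lambda>R. indicator {-R..R} x *\<^sub>R (h x * ?k x)) \<longlongrightarrow> h x * ?k x) at_top"
    proof (rule AE_I2)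
      fix x :: real
      have "\<forall>\<^sub>F R in at_top. R \<ge> \<bar>x\<bar>" by (rule eventually_ge_at_top)
      then have "\<forall>\<^sub>F R in at_top. h x * ?k x = indicator {-R..R} x *\<^sub>R (h x * ?k x)"
        by eventually_elim (auto simp: indicator_def)
      then show "((\<lambda>R. indicator {-R..R} x *\<^sub>R (h x * ?k x)) \<longlongrightarrow> h x * ?k x) at_top"
        by (rule Lim_transform_eventually[OF tendsto_const])
    qed
  qed measurable
qed

text \<open>Widening the Gaussian on the frequency side narrows it on the space side. The pairing
  then tends to \<open>h c\<close> by continuity, and to the inversion integral because
  \<open>F\<close> is an integrable majorant; the constant is the value at 0 of the normal
  density.\<close>

theorem fourier_inversion_continuous:
  assumes F: "is_fourier_L2 h F" and cont: "continuous_on UNIV h" and int: "integrable lborel F"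
  shows "h c = 1 / sqrt (2 * pi) * (LINT \<xi>|lborel. F \<xi> * cis (c * \<xi>))"
proof (rule LIMSEQ_unique)
  have h: "square_integrable h" and "square_integrable F"
    using F by (auto simp: is_fourier_L2_def)
  then have [measurable]: "h \<in> borel_measurable borel" "F \<in> borel_measurable borel"
    by (simp_all add: square_integrable_def)
  let ?k = "\<lambda>n x. real (Suc n) * std_normal_density (real (Suc n) * (x - c))"
  show "(\<lambda>n. LINT x|lborel. h x * ?k n x) \<longlonglongrightarrow> h c"
    by (rule gaussian_approximate_identity[OF h cont])
  have le: "std_normal_density z \<le> 1" for z
    using pi_ge_two mult_mono[of "1 / sqrt (2 * pi)" 1 "exp (- z\<^sup>2 / 2)" 1]
    by (simp add: std_normal_density_def)
  have "(\<lambda>n. LINT \<xi>|lborel. std_normal_density (\<xi> / real (Suc n)) * cis (c * \<xi>) * F \<xi>)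
      \<longlonglongrightarrow> (LINT \<xi>|lborel. 1 / sqrt (2 * pi) * (F \<xi> * cis (c * \<xi>)))"
  proof (rule integral_dominated_convergence)
    show "integrable lborel (\<lambda>\<xi>. norm (F \<xi>))" using int by (rule integrable_norm)
    show "AE \<xi> in lborel. norm (std_normal_density (\<xi> / real (Suc n)) * cis (c * \<xi>) * F \<xi>) \<le> norm (F \<xi>)" for n
      using le by (auto simp: norm_mult intro!: mult_left_le_one_le)
    show "AE \<xi> in lborel. (\<lambda>n. std_normal_density (\<xi> / real (Suc n)) * cis (c * \<xi>) * F \<xi>)
        \<longlonglongrightarrow> 1 / sqrt (2 * pi) * (F \<xi> * cis (c * \<xi>))"
    proof (rule AE_I2)
      fix \<xi> :: real
      have "(\<lambda>n. \<xi> / real (Suc n)) \<longlonglongrightarrow> 0" by real_asymp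
      then have "(\<lambda>n. 1 / sqrt (2 * pi) * exp (- (\<xi> / real (Suc n))\<^sup>2 / 2)) \<longlonglongrightarrow> 1 / sqrt (2 * pi) * exp (- 0\<^sup>2 / 2)"
        by (intro tendsto_intros) auto
      then have "(\<lambda>n. std_normal_density (\<xi> / real (Suc n))) \<longlonglongrightarrow> 1 / sqrt (2 * pi)"
        by (simp add: std_normal_density_def)
      then have "(\<lambda>n. std_normal_density (\<xi> / real (Suc n)) * cis (c * \<xi>) * F \<xi>)
        \<longlonglongrightarrow> complex_of_real (1 / sqrt (2 * pi)) * cis (c * \<xi>) * F \<xi>"
        by (intro tendsto_intros)
      then show "(\<lambda>n. std_normal_density (\<xi> / real (Suc n)) * cis (c * \<xi>) * F \<xi>)
        \<longlonglongrightarrow> 1 / sqrt (2 * pi) * (F \<xi> * cis (c * \<xi>))"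
        by (simp add: mult_ac)
    qed
  qed measurable
  then show "(\<lambda>n. LINT x|lborel. h x * ?k n x) \<longlonglongrightarrow> 1 / sqrt (2 * pi) * (LINT \<xi>|lborel. F \<xi> * cis (c * \<xi>))"
    using fourier_L2_pairing[OF F, of "real (Suc n)" c for n] by (simp only: integral_mult_right_zero)
qed

section \<open>Differences and uniqueness of L2 Fourier transforms, and the Sobolev
  embedding\<close>

lemma norm_diff_power2_le:
  fixes a b :: "'a :: real_normed_vector"
  shows "(norm (a - b))\<^sup>2 \<le> 2 * (norm a)\<^sup>2 + 2 * (norm b)\<^sup>2"
proof -
  have "(norm (a - b))\<^sup>2 \<le> (norm a + norm b)\<^sup>2"
    by (intro power_mono norm_triangle_ineq4) auto
  then show ?thesis
    using zero_le_power2[of "norm a - norm b"] by (simp add: power2_eq_square algebra_simps)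
qed

lemma nn_integral_norm_diff_power2_le:
  fixes a b :: "'a \<Rightarrow> complex"
  assumes [measurable]: "a \<in> borel_measurable M" "b \<in> borel_measurable M"
  shows "(\<integral>\<^sup>+x. ennreal ((norm (a x - b x))\<^sup>2) \<partial>M)
    \<le> 2 * (\<integral>\<^sup>+x. ennreal ((norm (a x))\<^sup>2) \<partial>M) + 2 * (\<integral>\<^sup>+x. ennreal ((norm (b x))\<^sup>2) \<partial>M)"
proof -
  have "ennreal ((norm (a x - b x))\<^sup>2) \<le> 2 * ennreal ((norm (a x))\<^sup>2) + 2 * ennreal ((norm (b x))\<^sup>2)" for x
    using ennreal_leI[OF norm_diff_power2_le[of "a x" "b x"]] by (simp add: ennreal_mult)
  then have "(\<integral>\<^sup>+x. ennreal ((norm (a x - b x))\<^sup>2) \<partial>M)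
    \<le> (\<integral>\<^sup>+x. 2 * ennreal ((norm (a x))\<^sup>2) + 2 * ennreal ((norm (b x))\<^sup>2) \<partial>M)"
    by (intro nn_integral_mono) auto
  also have "\<dots> = 2 * (\<integral>\<^sup>+x. ennreal ((norm (a x))\<^sup>2) \<partial>M) + 2 * (\<integral>\<^sup>+x. ennreal ((norm (b x))\<^sup>2) \<partial>M)"
    by (simp add: nn_integral_add nn_integral_cmult)
  finally show ?thesis .
qed

lemma square_integrable_diff:
  assumes "square_integrable f" "square_integrable g"
  shows "square_integrable (\<lambda>x. f x - g x)"
proof -
  have "integrable lborel (\<lambda>x. (norm (f x - g x))\<^sup>2)"
  proof (rule Bochner_Integration.integrable_bound)
    show "integrable lborel (\<lambda>x. 2 * (norm (f x))\<^sup>2 + 2 * (norm (g x))\<^sup>2)"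
      using assms by (auto simp: square_integrable_def)
  qed (use assms norm_diff_power2_le in \<open>auto simp: square_integrable_def\<close>)
  then show ?thesis using assms by (auto simp: square_integrable_def)
qed

lemma tendsto_zero_twice_add:
  fixes a b :: "'a \<Rightarrow> ennreal"
  assumes "(a \<longlongrightarrow> 0) net" "(b \<longlongrightarrow> 0) net"
  shows "((\<lambda>x. 2 * a x + 2 * b x) \<longlongrightarrow> 0) net"
proof -
  have "((\<lambda>x. 2 * a x + 2 * b x) \<longlongrightarrow> 2 * 0 + 2 * 0) net"
    by (intro tendsto_add ennreal_tendsto_cmult assms) auto
  then show ?thesis by simp
qed

text \<open>Continuity in time is a statement about \<open>u \<tau> - u t\<close>, which must itself
  be a member of the Sobolev space for the embedding to apply. The truncated transforms may be
  subtracted because square integrable functions are integrable on bounded intervals.\<close>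

lemma is_fourier_L2_diff:
  assumes F: "is_fourier_L2 h F" and G: "is_fourier_L2 k G"
  shows "is_fourier_L2 (\<lambda>x. h x - k x) (\<lambda>\<xi>. F \<xi> - G \<xi>)"
proof -
  have sq: "square_integrable h" "square_integrable k" "square_integrable F" "square_integrable G"
    using F G by (auto simp: is_fourier_L2_def)
  have [measurable]: "F \<in> borel_measurable borel" "G \<in> borel_measurable borel"
      "\<And>R. truncated_fourier h R \<in> borel_measurable borel" "\<And>R. truncated_fourier k R \<in> borel_measurable borel"
    using sq truncated_fourier_measurable by (auto simp: square_integrable_def)
  have int: "set_integrable lborel {-R..R} (\<lambda>x. f x * cis (- (x * \<xi>)))" if "square_integrable f" for f R \<xi>
    using square_integrable_imp_set_integrable[OF that, of "-R" R] unfolding set_integrable_def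
    by (rule Bochner_Integration.integrable_bound)
      (use that in \<open>auto simp: square_integrable_def norm_mult\<close>)
  have trunc: "truncated_fourier (\<lambda>x. h x - k x) R \<xi> = truncated_fourier h R \<xi> - truncated_fourier k R \<xi>" for R \<xi>
    unfolding truncated_fourier_def left_diff_distrib
    by (subst set_integral_diff(2)[OF int int]) (use sq in \<open>auto simp: right_diff_distrib\<close>)
  have "((\<lambda>R. \<integral>\<^sup>+\<xi>. ennreal ((norm ((F \<xi> - truncated_fourier h R \<xi>) - (G \<xi> - truncated_fourier k R \<xi>)))\<^sup>2) \<partial>lborel) \<longlongrightarrow> 0) at_top"
    by (rule tendsto_sandwich[OF _ _ tendsto_const tendsto_zero_twice_add])
      (use F G in \<open>auto simp: is_fourier_L2_def intro!: always_eventually nn_integral_norm_diff_power2_le\<close>)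
  then have "((\<lambda>R. \<integral>\<^sup>+\<xi>. ennreal ((norm ((F \<xi> - G \<xi>) - truncated_fourier (\<lambda>x. h x - k x) R \<xi>))\<^sup>2) \<partial>lborel) \<longlongrightarrow> 0) at_top"
    by (simp add: trunc algebra_simps)
  then show ?thesis
    using sq by (simp add: is_fourier_L2_def square_integrable_diff)
qed

lemma is_fourier_L2_unique:
  assumes F: "is_fourier_L2 h F" and G: "is_fourier_L2 h G"
  shows "AE \<xi> in lborel. F \<xi> = G \<xi>"
proof -
  have sq: "square_integrable h" "square_integrable F" "square_integrable G"
    using F G by (auto simp: is_fourier_L2_def)
  have [measurable]: "F \<in> borel_measurable borel" "G \<in> borel_measurable borel"
      "\<And>R. truncated_fourier h R \<in> borel_measurable borel"
    using sq truncated_fourier_measurable by (auto simp: square_integrable_def)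
  have "(\<integral>\<^sup>+\<xi>. ennreal ((norm (F \<xi> - G \<xi>))\<^sup>2) \<partial>lborel) \<le> 0"
  proof (rule tendsto_lowerbound)
    show "((\<lambda>R. 2 * (\<integral>\<^sup>+\<xi>. ennreal ((norm (F \<xi> - truncated_fourier h R \<xi>))\<^sup>2) \<partial>lborel)
        + 2 * (\<integral>\<^sup>+\<xi>. ennreal ((norm (G \<xi> - truncated_fourier h R \<xi>))\<^sup>2) \<partial>lborel)) \<longlongrightarrow> 0) at_top"
      using F G by (intro tendsto_zero_twice_add) (auto simp: is_fourier_L2_def)
    show "\<forall>\<^sub>F R in at_top. (\<integral>\<^sup>+\<xi>. ennreal ((norm (F \<xi> - G \<xi>))\<^sup>2) \<partial>lborel)
      \<le> 2 * (\<integral>\<^sup>+\<xi>. ennreal ((norm (F \<xi> - truncated_fourier h R \<xi>))\<^sup>2) \<partial>lborel)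
        + 2 * (\<integral>\<^sup>+\<xi>. ennreal ((norm (G \<xi> - truncated_fourier h R \<xi>))\<^sup>2) \<partial>lborel)"
      using nn_integral_norm_diff_power2_le[of "\<lambda>\<xi>. F \<xi> - truncated_fourier h R \<xi>" lborel
          "\<lambda>\<xi>. G \<xi> - truncated_fourier h R \<xi>" for R]
      by (intro always_eventually) simp
  qed simp
  then have "(\<integral>\<^sup>+\<xi>. ennreal ((norm (F \<xi> - G \<xi>))\<^sup>2) \<partial>lborel) = 0"
    by simp
  then show ?thesis
    by (subst (asm) nn_integral_0_iff_AE) auto
qed

text \<open>The transform selected by \<open>fourier_L2\<close> may differ from the witness in
  \<open>sobolev\<close>, but only on a null set; so the weighted integrability carries over, and
  \<open>sobolev_norm\<close> is an actual integral rather than a default 0.\<close>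

lemma sobolev_fourier_L2:
  assumes "h \<in> sobolev s"
  shows "is_fourier_L2 (\<lambda>x. complex_of_real (h x)) (fourier_L2 (\<lambda>x. complex_of_real (h x)))"
    and "integrable lborel (\<lambda>\<xi>. (1 + \<xi>\<^sup>2) powr s * (norm (fourier_L2 (\<lambda>x. complex_of_real (h x)) \<xi>))\<^sup>2)"
proof -
  let ?h = "\<lambda>x. complex_of_real (h x)"
  obtain F where F: "is_fourier_L2 ?h F" and int: "integrable lborel (\<lambda>\<xi>. (1 + \<xi>\<^sup>2) powr s * (norm (F \<xi>))\<^sup>2)"
    using assms by (auto simp: sobolev_def)
  show G: "is_fourier_L2 ?h (fourier_L2 ?h)"
    unfolding fourier_L2_def by (rule someI[of "is_fourier_L2 ?h", OF F])
  have [measurable]: "F \<in> borel_measurable borel" "fourier_L2 ?h \<in> borel_measurable borel"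
    using F G by (auto simp: is_fourier_L2_def square_integrable_def)
  have "AE \<xi> in lborel. (1 + \<xi>\<^sup>2) powr s * (norm (F \<xi>))\<^sup>2 = (1 + \<xi>\<^sup>2) powr s * (norm (fourier_L2 ?h \<xi>))\<^sup>2"
    using is_fourier_L2_unique[OF F G] by eventually_elim simp
  then show "integrable lborel (\<lambda>\<xi>. (1 + \<xi>\<^sup>2) powr s * (norm (fourier_L2 ?h \<xi>))\<^sup>2)"
    using int by (subst (asm) integrable_cong_AE) auto
qed

lemma sobolev_diff:
  assumes "h \<in> sobolev s" "k \<in> sobolev s"
  shows "(\<lambda>x. h x - k x) \<in> sobolev s"
proof -
  let ?F = "fourier_L2 (\<lambda>x. complex_of_real (h x))" and ?G = "fourier_L2 (\<lambda>x. complex_of_real (k x))"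
  note F = sobolev_fourier_L2[OF assms(1)] and G = sobolev_fourier_L2[OF assms(2)]
  have [measurable]: "?F \<in> borel_measurable borel" "?G \<in> borel_measurable borel"
    using F G by (auto simp: is_fourier_L2_def square_integrable_def)
  have "integrable lborel (\<lambda>\<xi>. (1 + \<xi>\<^sup>2) powr s * (norm (?F \<xi> - ?G \<xi>))\<^sup>2)"
  proof (rule Bochner_Integration.integrable_bound)
    show "integrable lborel (\<lambda>\<xi>. 2 * ((1 + \<xi>\<^sup>2) powr s * (norm (?F \<xi>))\<^sup>2) + 2 * ((1 + \<xi>\<^sup>2) powr s * (norm (?G \<xi>))\<^sup>2))"
      using F G by (intro Bochner_Integration.integrable_add integrable_mult_right) auto
    have "(1 + \<xi>\<^sup>2) powr s * (norm (?F \<xi> - ?G \<xi>))\<^sup>2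
        \<le> 2 * ((1 + \<xi>\<^sup>2) powr s * (norm (?F \<xi>))\<^sup>2) + 2 * ((1 + \<xi>\<^sup>2) powr s * (norm (?G \<xi>))\<^sup>2)" for \<xi>
      using mult_left_mono[OF norm_diff_power2_le[of "?F \<xi>" "?G \<xi>"], of "(1 + \<xi>\<^sup>2) powr s"]
      by (simp add: algebra_simps)
    then show "AE \<xi> in lborel. norm ((1 + \<xi>\<^sup>2) powr s * (norm (?F \<xi> - ?G \<xi>))\<^sup>2)
        \<le> norm (2 * ((1 + \<xi>\<^sup>2) powr s * (norm (?F \<xi>))\<^sup>2) + 2 * ((1 + \<xi>\<^sup>2) powr s * (norm (?G \<xi>))\<^sup>2))"
      by simp
  qed measurable
  then show ?thesis
    using is_fourier_L2_diff[OF F(1) G(1)] by (auto simp: sobolev_def)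
qed

text \<open>Continuity of \<open>h\<close> selects the representative for which inversion holds
  everywhere. The weighted integral of the transform then bounds \<open>h\<close> and its
  derivative; the factor \<open>1 / sqrt (2 * pi)\<close> is estimated by 1.\<close>

lemma sobolev_embedding_C1:
  assumes h: "h \<in> sobolev s" and s: "s > 3 / 2" and cont: "continuous_on UNIV h"
  defines "I \<equiv> (sobolev_norm s h)\<^sup>2 / 2 + (LINT \<xi>|lborel. (1 + \<xi>\<^sup>2) powr (1 - s))"
  shows "h differentiable (at x)" and "\<bar>h x\<bar> \<le> I" and "\<bar>deriv h x\<bar> \<le> I"
proof -
  let ?h = "\<lambda>x. complex_of_real (h x)"
  let ?F = "fourier_L2 ?h"
  note F = sobolev_fourier_L2[OF h]
  have meas [measurable]: "?F \<in> borel_measurable lborel"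
    using F by (auto simp: is_fourier_L2_def square_integrable_def)
  note w = integrable_one_plus_abs_mult_norm[OF meas s F(2)]
  define J where "J = (LINT \<xi>|lborel. (1 + \<bar>\<xi>\<bar>) * norm (?F \<xi>))"
  have "(sobolev_norm s h)\<^sup>2 = (LINT \<xi>|lborel. (1 + \<xi>\<^sup>2) powr s * (norm (?F \<xi>))\<^sup>2)"
    unfolding sobolev_norm_def by (intro real_sqrt_pow2 integral_nonneg_AE) auto
  then have JI: "J \<le> I"
    using w(2) by (simp add: I_def J_def)
  have intF: "integrable lborel ?F"
    using w(1) by (rule Bochner_Integration.integrable_bound) (auto simp: mult_le_cancel_right1)
  have cont': "continuous_on UNIV ?h"
    using cont by (intro continuous_intros)
  have inv: "h y = 1 / sqrt (2 * pi) * Re (LINT \<xi>|lborel. ?F \<xi> * cis (y * \<xi>))" for y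
  proof -
    have "complex_of_real (h y) = (1 / sqrt (2 * pi)) *\<^sub>R (LINT \<xi>|lborel. ?F \<xi> * cis (y * \<xi>))"
      using fourier_inversion_continuous[OF F(1) cont' intF, of y] by (simp add: scaleR_conv_of_real)
    then have "Re (complex_of_real (h y)) = Re ((1 / sqrt (2 * pi)) *\<^sub>R (LINT \<xi>|lborel. ?F \<xi> * cis (y * \<xi>)))"
      by (rule arg_cong)
    then show ?thesis
      unfolding Re_complex_of_real scaleR_complex.sel by simp
  qed
  obtain D where D: "\<And>x. ((\<lambda>x. Re (LINT \<xi>|lborel. ?F \<xi> * cis (x * \<xi>))) has_real_derivative D x) (at x)"
    and D_le: "\<And>x. \<bar>D x\<bar> \<le> J" and h_le: "\<And>x. \<bar>Re (LINT \<xi>|lborel. ?F \<xi> * cis (x * \<xi>))\<bar> \<le> J"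
    using DERIV_Re_inverse_fourier[OF meas w(1)] unfolding J_def by blast
  have le: "\<bar>1 / sqrt (2 * pi) * y\<bar> \<le> I" if "\<bar>y\<bar> \<le> J" for y
  proof -
    have "\<bar>1 / sqrt (2 * pi) * y\<bar> \<le> 1 * J"
      unfolding abs_mult using pi_ge_two that by (intro mult_mono) auto
    then show ?thesis using JI by simp
  qed
  show "\<bar>h x\<bar> \<le> I"
    by (subst inv) (rule le[OF h_le])
  have "(h has_real_derivative 1 / sqrt (2 * pi) * D x) (at x)"
    using DERIV_cmult[OF D, of "1 / sqrt (2 * pi)" x] by (simp only: inv[symmetric])
  then show "h differentiable (at x)" "\<bar>deriv h x\<bar> \<le> I"
    using le[OF D_le[of x]] by (auto simp: real_differentiable_def DERIV_imp_deriv)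
qed

text \<open>Near a fixed time the embedding is applied twice, to \<open>u t\<close> and to the
  difference \<open>u \<tau> - u t\<close>, and the results are added pointwise. Compactness of the
  time interval then makes the local bounds uniform.\<close>

lemma C0_sobolev_uniform_C1_bound:
  assumes u: "u \<in> C0_sobolev T s" and s: "s > 3 / 2"
    and cont: "\<And>t. t \<in> {0..T} \<Longrightarrow> continuous_on UNIV (u t)"
  obtains B where "\<And>t x. t \<in> {0..T} \<Longrightarrow> \<bar>u t x\<bar> \<le> B" and "\<And>t x. t \<in> {0..T} \<Longrightarrow> \<bar>deriv (u t) x\<bar> \<le> B"
proof -
  define c where "c = (LINT \<xi>|lborel. (1 + \<xi>\<^sup>2) powr (1 - s))"
  \<comment> \<open>The bound for \<open>u t\<close>, plus \<open>c + 1\<close> for a difference of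
    norm at most 1.\<close>
  define b where "b t = (sobolev_norm s (u t))\<^sup>2 / 2 + 2 * c + 1" for t
  have c0: "c \<ge> 0" unfolding c_def by (intro integral_nonneg_AE) auto
  have sob: "u t \<in> sobolev s" if "t \<in> {0..T}" for t
    using u that by (auto simp: C0_sobolev_def)
  have emb: "u t differentiable (at x)" "\<bar>u t x\<bar> \<le> (sobolev_norm s (u t))\<^sup>2 / 2 + c"
      "\<bar>deriv (u t) x\<bar> \<le> (sobolev_norm s (u t))\<^sup>2 / 2 + c" if "t \<in> {0..T}" for t x
    using sobolev_embedding_C1[OF sob[OF that] s cont[OF that]] by (auto simp: c_def)
  have "\<exists>d>0. \<forall>\<tau>\<in>{0..T}. dist \<tau> t < d \<longrightarrow> (\<forall>x. \<bar>u \<tau> x\<bar> \<le> b t \<and> \<bar>deriv (u \<tau>) x\<bar> \<le> b t)"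
    if t: "t \<in> {0..T}" for t
  proof -
    have "((\<lambda>\<tau>. sobolev_norm s (\<lambda>x. u \<tau> x - u t x)) \<longlongrightarrow> 0) (at t within {0..T})"
      using u t by (auto simp: C0_sobolev_def)
    then have "\<forall>\<^sub>F \<tau> in at t within {0..T}. dist (sobolev_norm s (\<lambda>x. u \<tau> x - u t x)) 0 < 1"
      by (rule tendstoD) simp
    then obtain d where d: "d > 0"
      and near: "\<And>\<tau>. \<tau> \<in> {0..T} \<Longrightarrow> \<tau> \<noteq> t \<Longrightarrow> dist \<tau> t < d \<Longrightarrow> \<bar>sobolev_norm s (\<lambda>x. u \<tau> x - u t x)\<bar> < 1"
      unfolding eventually_at by auto
    have "\<bar>u \<tau> x\<bar> \<le> b t \<and> \<bar>deriv (u \<tau>) x\<bar> \<le> b t" if \<tau>: "\<tau> \<in> {0..T}" "dist \<tau> t < d" for \<tau> x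
    \<comment> \<open>The limit in \<open>C0_sobolev\<close> is punctured and says nothing about
      \<open>\<tau> = t\<close>; there the bound for \<open>u t\<close> alone suffices.\<close>
    proof (cases "\<tau> = t")
      case True
      then show ?thesis using emb(2,3)[OF t, of x] c0 by (simp add: b_def)
    next
      case False
      let ?w = "\<lambda>x. u \<tau> x - u t x"
      have w: "?w \<in> sobolev s" "continuous_on UNIV ?w"
        using sobolev_diff sob cont \<tau> t by (auto intro: continuous_on_diff)
      note emb_w = sobolev_embedding_C1[OF w(1) s w(2), folded c_def]
      have "(sobolev_norm s ?w)\<^sup>2 \<le> 1"
        using near[OF \<tau>(1) False \<tau>(2)] by (simp add: abs_square_le_1)
      then have "\<bar>?w x\<bar> \<le> c + 1" "\<bar>deriv ?w x\<bar> \<le> c + 1"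
        using emb_w(2,3)[of x] by auto
      moreover have "deriv ?w x = deriv (u \<tau>) x - deriv (u t) x"
        using emb(1)[OF \<tau>(1), of x] emb(1)[OF t, of x]
        by (intro deriv_diff) (auto simp: field_differentiable_def real_differentiable_def)
      ultimately show ?thesis
        using emb(2,3)[OF t, of x] unfolding b_def by linarith
    qed
    then show ?thesis using d by blast
  qed
  then obtain d where d: "\<And>t. t \<in> {0..T} \<Longrightarrow> d t > 0"
    and bd: "\<And>t \<tau> x. t \<in> {0..T} \<Longrightarrow> \<tau> \<in> {0..T} \<Longrightarrow> dist \<tau> t < d t \<Longrightarrow> \<bar>u \<tau> x\<bar> \<le> b t \<and> \<bar>deriv (u \<tau>) x\<bar> \<le> b t"
    by metis
  obtain C where C: "C \<subseteq> {0..T}" "finite C" "{0..T} \<subseteq> (\<Union>t\<in>C. ball t (d t))"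
  proof (rule compactE_image[of "{0..T}" "{0..T}" "\<lambda>t. ball t (d t)"])
    show "{0..T} \<subseteq> (\<Union>t\<in>{0..T}. ball t (d t))" using d by force
  qed auto
  have b0: "b t \<ge> 0" for t using c0 by (simp add: b_def)
  have "\<bar>u \<tau> x\<bar> \<le> sum b C \<and> \<bar>deriv (u \<tau>) x\<bar> \<le> sum b C" if \<tau>: "\<tau> \<in> {0..T}" for \<tau> x
  proof -
    obtain t where t: "t \<in> C" "dist \<tau> t < d t" using C(3) \<tau> by (auto simp: dist_commute)
    have "b t \<le> sum b C" using C(2) t(1) b0 by (intro member_le_sum) auto
    then show ?thesis using bd[of t \<tau> x] t C(1) \<tau> by force
  qed
  then show ?thesis using that by blast
qed

section \<open>A maximum principle for transport equations\<close>

lemma DERIV_sqrt_shifted_square: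
  fixes c z :: real
  assumes "c \<noteq> 0"
  shows "((\<lambda>z. sqrt (c\<^sup>2 + z\<^sup>2)) has_real_derivative z / sqrt (c\<^sup>2 + z\<^sup>2)) (at z)"
proof -
  have "c\<^sup>2 + z\<^sup>2 > 0"
    using assms by (simp add: add_pos_nonneg)
  then show ?thesis
    by (auto intro!: derivative_eq_intros simp: divide_simps)
qed

lemma abs_le_sqrt_shifted_square: "\<bar>z\<bar> \<le> sqrt (c\<^sup>2 + z\<^sup>2)" for z c :: real
  by (metis real_sqrt_abs real_sqrt_le_mono le_add_same_cancel2 zero_le_power2)

lemma abs_div_sqrt_shifted_square: "\<bar>z / sqrt (c\<^sup>2 + z\<^sup>2)\<bar> \<le> 1" for z c :: real
proof -
  have "\<bar>z\<bar> / sqrt (c\<^sup>2 + z\<^sup>2) \<le> 1"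
    using abs_le_sqrt_shifted_square[of z c] by (intro divide_le_eq_1[THEN iffD2]) (auto simp: add_nonneg_eq_0_iff less_le)
  then show ?thesis by simp
qed

text \<open>The doubled-variable maximum principle. The difference quotient is compared with
  \<open>K t \<surd>(\<eta>\<^sup>2 + (x - y)\<^sup>2)\<close>, which is smooth across the diagonal; the penalty with weight
  \<open>\<epsilon>\<close> makes the maximum exist although nothing is assumed about decay at infinity.\<close>

lemma transport_lipschitz_bound:
  fixes v a F v' :: "real \<Rightarrow> real \<Rightarrow> real"
  assumes L: "0 \<le> L" "\<delta> * L \<le> 1 / 2" and M: "0 < M" and A: "0 < A"
    and cont: "continuous_on ({0..\<delta>} \<times> UNIV) (\<lambda>(t, x). v t x)"
    and bound: "\<And>t x. t \<in> {0..\<delta>} \<Longrightarrow> \<bar>v t x\<bar> \<le> B"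
    and init: "\<And>x. v 0 x = 0"
    and eq: "\<And>t x. t \<in> {0..\<delta>} \<Longrightarrow>
      ((\<lambda>\<tau>. v \<tau> x) has_real_derivative F t x - a t x * v' t x) (at t within {0..\<delta>})"
    and dx: "\<And>t x. t \<in> {0..\<delta>} \<Longrightarrow> (v t has_real_derivative v' t x) (at x)"
    and a: "\<And>t x. t \<in> {0..\<delta>} \<Longrightarrow> \<bar>a t x\<bar> \<le> A"
    and a_lip: "\<And>t x y. t \<in> {0..\<delta>} \<Longrightarrow> \<bar>a t x - a t y\<bar> \<le> L * \<bar>x - y\<bar>"
    and F_lip: "\<And>t x y. t \<in> {0..\<delta>} \<Longrightarrow> \<bar>F t x - F t y\<bar> \<le> M * \<bar>x - y\<bar>"
    and t: "t \<in> {0..\<delta>}"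
  shows "v t x - v t y \<le> 4 * M * t * \<bar>x - y\<bar>"
proof (rule ccontr)
  \<comment> \<open>The slope budget at the maximum: since \<open>M = K / 4\<close>, the source
    spends a quarter of \<open>K\<close>, the variation of the velocity at most a half by
    \<open>\<delta> * L \<le> 1 / 2\<close>, and the penalty less than the remaining
    quarter.\<close>
  define K where "K = 4 * M"
  assume "\<not> ?thesis"
  then have D: "v t x - v t y - K * t * \<bar>x - y\<bar> > 0" (is "?D > 0")
    by (simp add: K_def)
  have K: "K > 0" and t0: "t \<ge> 0" using M t by (auto simp: K_def)
  \<comment> \<open>Small enough that rounding off \<open>\<bar>x - y\<bar>\<close> to
    \<open>\<rho>\<close> costs at most half of the excess \<open>?D\<close>.\<close>
  define \<eta> where "\<eta> = ?D / (2 * (K * t + 1))"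
  have Kt: "K * t \<ge> 0" using K t0 by simp
  have \<eta>: "\<eta> > 0" using D Kt by (simp add: \<eta>_def)
  define \<rho> where "\<rho> z = sqrt (\<eta>\<^sup>2 + z\<^sup>2)" for z :: real
  define j where "j z = sqrt (1\<^sup>2 + z\<^sup>2)" for z :: real
  have \<rho>_ge: "\<rho> z \<ge> \<eta>" "\<rho> z \<ge> \<bar>z\<bar>" for z
    using \<eta> abs_le_sqrt_shifted_square[of z \<eta>] by (auto simp: \<rho>_def intro: real_le_rsqrt)
  have j_ge: "j z \<ge> \<bar>z\<bar>" "j z > 0" for z
    using abs_le_sqrt_shifted_square[of z 1] by (auto simp: j_def intro: add_pos_nonneg)
  have "\<rho> (x - y) \<le> \<eta> + \<bar>x - y\<bar>"
    using \<eta> sqrt_add_le_add_sqrt[of "\<eta>\<^sup>2" "(x - y)\<^sup>2"] by (simp add: \<rho>_def)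
  then have "K * t * \<rho> (x - y) \<le> K * t * \<eta> + K * t * \<bar>x - y\<bar>"
    using Kt by (metis distrib_left mult_left_mono)
  moreover have "K * t * \<eta> \<le> ?D / 2"
  proof -
    have "K * t * \<eta> = ?D / 2 * (K * t / (K * t + 1))"
      using Kt by (simp add: \<eta>_def field_simps)
    also have "\<dots> \<le> ?D / 2 * 1"
      using D Kt by (intro mult_left_mono) auto
    finally show ?thesis by simp
  qed
  ultimately have "K * t * \<rho> (x - y) \<le> ?D / 2 + K * t * \<bar>x - y\<bar>"
    by (rule order_trans[OF _ add_right_mono])
  then have D': "v t x - v t y - K * t * \<rho> (x - y) > 0" (is "?D' > 0")
    using D by argo
  \<comment> \<open>The first entry keeps the penalized function positive at the given point; the
    second makes the penalty's share \<open>2 * A * \<epsilon>\<close> less than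
    \<open>K * \<eta> / 4\<close>.\<close>
  define \<epsilon> where "\<epsilon> = min (?D' / (2 * (j x + j y))) (K * \<eta> / (16 * A))"
  have jxy: "j x + j y > 0" using j_ge(2) by (simp add: add_pos_pos)
  have \<epsilon>: "\<epsilon> > 0" using D' jxy K \<eta> A by (simp add: \<epsilon>_def)
  have "\<epsilon> * (j x + j y) \<le> ?D' / (2 * (j x + j y)) * (j x + j y)"
    using jxy by (intro mult_right_mono) (auto simp: \<epsilon>_def)
  also have "\<dots> = ?D' / 2"
    using jxy by (simp del: distrib_left_numeral)
  finally have \<epsilon>1: "\<epsilon> * (j x + j y) < ?D'"
    using D' by argo
  have "2 * A * \<epsilon> \<le> 2 * A * (K * \<eta> / (16 * A))"
    using A by (intro mult_left_mono) (auto simp: \<epsilon>_def)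
  also have "\<dots> = K * \<eta> / 8"
    using A by simp
  also have "\<dots> < K * \<eta> / 4"
    using K \<eta> by simp
  finally have \<epsilon>2: "2 * A * \<epsilon> < K * \<eta> / 4" .
  define \<psi> where "\<psi> p = (case p of (t, x, y) \<Rightarrow>
    v t x - v t y - K * t * \<rho> (x - y) - \<epsilon> * (j x + j y))" for p
  \<comment> \<open>Beyond this radius the penalty exceeds \<open>2 * \<bar>B\<bar>\<close>, the
    largest possible value of the difference, so a positive maximum must lie in the compact
    box.\<close>
  define R where "R = 2 * \<bar>B\<bar> / \<epsilon>"
  have small: "\<psi> (s, x, y) \<le> 0" if "s \<in> {0..\<delta>}" "x \<notin> {-R..R} \<or> y \<notin> {-R..R}" for s x y
  proof -
    have "j x + j y > R" using that j_ge(1)[of x] j_ge(1)[of y] j_ge(2)[of x] j_ge(2)[of y] by auto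
    then have "\<epsilon> * (j x + j y) \<ge> 2 * \<bar>B\<bar>"
      using \<epsilon> by (simp add: R_def pos_divide_less_eq mult.commute)
    moreover have "v s x - v s y \<le> 2 * \<bar>B\<bar>"
      using bound[OF that(1), of x] bound[OF that(1), of y] by linarith
    moreover have "K * s * \<rho> (x - y) \<ge> 0"
      using K that(1) \<eta> \<rho>_ge(1)[of "x - y"] by auto
    ultimately show ?thesis by (simp add: \<psi>_def)
  qed
  have pos: "\<psi> (t, x, y) > 0" using \<epsilon>1 by (simp add: \<psi>_def)
  let ?C = "{0..\<delta>} \<times> {-R..R} \<times> {-R..R}"
  have "continuous_on ?C \<psi>"
  proof -
    have "continuous_on ?C (\<lambda>p. v (fst p) (fst (snd p)))"
      by (rule continuous_on_compose2[OF cont, where f = "\<lambda>p. (fst p, fst (snd p))", unfolded split_beta fst_conv snd_conv])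
        (auto intro!: continuous_intros)
    moreover have "continuous_on ?C (\<lambda>p. v (fst p) (snd (snd p)))"
      by (rule continuous_on_compose2[OF cont, where f = "\<lambda>p. (fst p, snd (snd p))", unfolded split_beta fst_conv snd_conv])
        (auto intro!: continuous_intros)
    ultimately show ?thesis
      unfolding \<psi>_def split_beta \<rho>_def j_def by (auto intro!: continuous_intros)
  qed
  moreover have tC: "(t, x, y) \<in> ?C" using small[OF t, of x y] pos t by force
  ultimately obtain p where p: "p \<in> ?C" "\<And>q. q \<in> ?C \<Longrightarrow> \<psi> q \<le> \<psi> p"
    using continuous_attains_sup[of ?C \<psi>] by (auto simp: compact_Times)
  obtain t' x' y' where p_eq: "p = (t', x', y')" by (metis prod_cases3)
  have t': "t' \<in> {0..\<delta>}" using p(1) p_eq by auto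
  have pos': "\<psi> (t', x', y') > 0" using p(2)[OF tC] pos p_eq by simp
  have max: "\<psi> (s, z, w) \<le> \<psi> (t', x', y')" if "s \<in> {0..\<delta>}" for s z w
    using small[OF that, of z w] p(2)[of "(s, z, w)"] pos' that p_eq by force
  have "t' \<noteq> 0"
    using pos' init j_ge(2)[of x'] j_ge(2)[of y'] \<epsilon> by (auto simp: \<psi>_def mult_less_0_iff)
  then have t'0: "t' > 0" using t' by auto
  define Z where "Z = x' - y'"
  have d\<rho>: "(\<rho> has_real_derivative z / \<rho> z) (at z)" for z
    unfolding \<rho>_def using DERIV_sqrt_shifted_square \<eta> by simp
  have dj: "(j has_real_derivative z / j z) (at z)" for z
    unfolding j_def by (rule DERIV_sqrt_shifted_square) simp
  \<comment> \<open>The point of doubling the variables: at the maximum \<open>v'\<close> has the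
    same value at \<open>x'\<close> and \<open>y'\<close>, up to terms in \<open>\<epsilon>\<close>.
    The transport terms therefore combine into a difference of velocities times a known slope, and
    no second derivative of \<open>v\<close> appears.\<close>
  have max_x: "v' t' x' = K * t' * (Z / \<rho> Z) + \<epsilon> * (x' / j x')"
  proof -
    have "((\<lambda>x. \<psi> (t', x, y')) has_real_derivative
        v' t' x' - K * t' * (Z / \<rho> Z) - \<epsilon> * (x' / j x')) (at x')"
      unfolding \<psi>_def split_beta fst_conv snd_conv Z_def
      by (auto intro!: derivative_eq_intros dx[OF t'] dj DERIV_chain2[OF d\<rho>] simp: algebra_simps diff_divide_distrib)
    then have "v' t' x' - K * t' * (Z / \<rho> Z) - \<epsilon> * (x' / j x') = 0"
      by (rule DERIV_local_max[where d = 1]) (use max t' in auto)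
    then show ?thesis by simp
  qed
  have max_y: "v' t' y' = K * t' * (Z / \<rho> Z) - \<epsilon> * (y' / j y')"
  proof -
    have "((\<lambda>y. \<psi> (t', x', y)) has_real_derivative
        - v' t' y' + K * t' * (Z / \<rho> Z) - \<epsilon> * (y' / j y')) (at y')"
      unfolding \<psi>_def split_beta fst_conv snd_conv Z_def
      by (auto intro!: derivative_eq_intros dx[OF t'] dj DERIV_chain2[OF d\<rho>] simp: algebra_simps diff_divide_distrib)
    then have "- v' t' y' + K * t' * (Z / \<rho> Z) - \<epsilon> * (y' / j y') = 0"
      by (rule DERIV_local_max[where d = 1]) (use max t' in auto)
    then show ?thesis by simp
  qed
  \<comment> \<open>The maximum may sit at the final time \<open>\<delta>\<close>, where the
    derivative is one-sided. Steps backwards, possible because \<open>t' > 0\<close>, already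
    exclude a negative value.\<close>
  have "(F t' x' - a t' x' * v' t' x') - (F t' y' - a t' y' * v' t' y') - K * \<rho> Z \<ge> 0" (is "?d \<ge> 0")
  proof (rule ccontr)
    assume "\<not> ?thesis"
    moreover have "((\<lambda>s. \<psi> (s, x', y')) has_real_derivative ?d) (at t' within {0..\<delta>})"
      unfolding \<psi>_def split_beta fst_conv snd_conv Z_def
      using eq[OF t', of x'] eq[OF t', of y'] by (auto intro!: derivative_eq_intros)
    ultimately obtain d where d: "d > 0"
      "\<And>h. h > 0 \<Longrightarrow> t' - h \<in> {0..\<delta>} \<Longrightarrow> h < d \<Longrightarrow> \<psi> (t', x', y') < \<psi> (t' - h, x', y')"
      using has_real_derivative_neg_dec_left[of "\<lambda>s. \<psi> (s, x', y')" ?d t' "{0..\<delta>}"] by force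
    define h where "h = min (d / 2) (t' / 2)"
    have "h > 0" "h < d" "t' - h \<in> {0..\<delta>}" using d(1) t'0 t' by (auto simp: h_def min_def)
    then show False using d(2)[of h] max[of "t' - h" x' y'] by auto
  qed
  then have "K * \<rho> Z \<le> (F t' x' - F t' y') - (a t' x' - a t' y') * (K * t' * (Z / \<rho> Z))
      - \<epsilon> * (a t' x' * (x' / j x') + a t' y' * (y' / j y'))"
    unfolding max_x max_y by (simp add: algebra_simps diff_divide_distrib)
  moreover have "F t' x' - F t' y' \<le> K / 4 * \<rho> Z"
  proof -
    have "F t' x' - F t' y' \<le> M * \<bar>Z\<bar>" using F_lip[OF t', of x' y'] by (simp add: Z_def)
    also have "\<dots> \<le> M * \<rho> Z" using \<rho>_ge(2)[of Z] M by (intro mult_left_mono) auto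
    finally show ?thesis by (simp add: K_def)
  qed
  moreover have "- ((a t' x' - a t' y') * (K * t' * (Z / \<rho> Z))) \<le> K / 2 * \<rho> Z"
  proof -
    have "\<bar>(a t' x' - a t' y') * (K * t' * (Z / \<rho> Z))\<bar> = \<bar>a t' x' - a t' y'\<bar> * (K * t' * \<bar>Z / \<rho> Z\<bar>)"
      using K t'0 by (simp add: abs_mult)
    also have "\<dots> \<le> (L * \<bar>Z\<bar>) * (K * \<delta> * 1)"
      using a_lip[OF t', of x' y'] K t' abs_div_sqrt_shifted_square[of Z \<eta>] L
      unfolding Z_def[symmetric] \<rho>_def[symmetric]
      by (intro mult_mono) auto
    also have "\<dots> = (\<delta> * L) * (K * \<bar>Z\<bar>)" by simp
    also have "\<dots> \<le> 1 / 2 * (K * \<rho> Z)"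
      using L K t' \<rho>_ge(2)[of Z] by (intro mult_mono) auto
    finally show ?thesis by linarith
  qed
  moreover have "- (\<epsilon> * (a t' x' * (x' / j x') + a t' y' * (y' / j y'))) \<le> 2 * A * \<epsilon>"
  proof -
    have aj: "\<bar>a t' z * (z / j z)\<bar> \<le> A * 1" for z
      unfolding abs_mult using a[OF t', of z] A abs_div_sqrt_shifted_square[of z 1]
      by (intro mult_mono) (auto simp: j_def)
    have "- (a t' x' * (x' / j x') + a t' y' * (y' / j y')) \<le> 2 * A"
      using aj[of x'] aj[of y'] by linarith
    then have "\<epsilon> * - (a t' x' * (x' / j x') + a t' y' * (y' / j y')) \<le> \<epsilon> * (2 * A)"
      using \<epsilon> by (intro mult_left_mono) auto
    then show ?thesis by (simp add: algebra_simps)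
  qed
  ultimately have "K * \<rho> Z \<le> K / 4 * \<rho> Z + K / 2 * \<rho> Z + 2 * A * \<epsilon>" by linarith
  moreover have "K * \<eta> \<le> K * \<rho> Z" using K \<rho>_ge(1)[of Z] by simp
  ultimately show False using \<epsilon>2 by simp
qed

section \<open>Vanishing and its propagation in time\<close>

lemma smooth_deriv:
  assumes "smooth f"
  shows "smooth (deriv f)"
  using assms unfolding smooth_def by (metis comp_apply funpow_Suc_right)

lemma smooth_imp_DERIV:
  assumes "smooth f"
  shows "(f has_real_derivative deriv f x) (at x)"
proof -
  have "f differentiable (at x)"
    using assms unfolding smooth_def by (metis funpow_0)
  then show ?thesis
    by (metis DERIV_imp_deriv real_differentiable_def)
qed

lemma smooth_imp_continuous:
  assumes "smooth f"
  shows "continuous_on UNIV f"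
  using smooth_imp_DERIV[OF assms] by (auto intro: DERIV_continuous_on DERIV_subset)

lemma continuous_abs_bounded_on_Icc:
  fixes f :: "real \<Rightarrow> real"
  assumes "continuous_on UNIV f"
  obtains K where "K > 0" "\<And>x. \<bar>x\<bar> \<le> B \<Longrightarrow> \<bar>f x\<bar> \<le> K"
proof -
  have "compact (f ` {-B..B})"
    using assms by (intro compact_continuous_image continuous_on_subset[OF assms]) auto
  then obtain K where K: "K > 0" "\<forall>y\<in>f ` {-B..B}. norm y \<le> K"
    using compact_imp_bounded bounded_pos by metis
  have "\<bar>f x\<bar> \<le> K" if "\<bar>x\<bar> \<le> B" for x
  proof -
    have "f x \<in> f ` {-B..B}" using that by (intro imageI) auto
    then show ?thesis using K(2) by auto
  qed
  then show ?thesis using that K(1) by blast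
qed

lemma DERIV_bounded_imp_lipschitz_on_Icc:
  fixes f :: "real \<Rightarrow> real"
  assumes "\<And>x. (f has_real_derivative f' x) (at x)" and "\<And>x. \<bar>x\<bar> \<le> B \<Longrightarrow> \<bar>f' x\<bar> \<le> K"
    and "\<bar>x\<bar> \<le> B" "\<bar>y\<bar> \<le> B"
  shows "\<bar>f x - f y\<bar> \<le> K * \<bar>x - y\<bar>"
proof -
  have "norm (f x - f y) \<le> K * norm (x - y)"
    by (rule field_differentiable_bound[of "{-B..B}" f f'])
      (use assms in \<open>auto intro: has_field_derivative_at_within\<close>)
  then show ?thesis by simp
qed

lemma abs_DERIV_le_lipschitz:
  fixes f :: "real \<Rightarrow> real"
  assumes D: "(f has_real_derivative D) (at x)" and lip: "\<And>y. \<bar>f x - f y\<bar> \<le> K * \<bar>x - y\<bar>"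
  shows "\<bar>D\<bar> \<le> K"
proof -
  have "((\<lambda>y. (f y - f x) / (y - x)) \<longlongrightarrow> D) (at x)"
    using D by (simp add: has_field_derivative_iff)
  then show ?thesis
    unfolding real_norm_def[symmetric]
  proof (rule Lim_norm_ubound[rotated])
    have "norm ((f y - f x) / (y - x)) \<le> K" if "y \<noteq> x" for y
      using lip[of y] that by (simp add: divide_le_eq abs_minus_commute)
    then show "\<forall>\<^sub>F y in at x. norm ((f y - f x) / (y - x)) \<le> K"
      by (auto simp: eventually_at_filter)
  qed simp
qed

text \<open>The embedding supplies the existence and boundedness of the derivative, not its
  continuity; as a pointwise limit of continuous quotients it is at least Borel, which is what the
  density must be.\<close>

lemma borel_measurable_deriv:
  fixes w :: "real \<Rightarrow> real"
  assumes cont: "continuous_on UNIV w" and D: "\<And>x. (w has_real_derivative deriv w x) (at x)"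
  shows "deriv w \<in> borel_measurable borel"
proof (rule borel_measurable_LIMSEQ_real)
  have [measurable]: "w \<in> borel_measurable borel"
    using cont by (rule borel_measurable_continuous_onI)
  show "(\<lambda>x. (w (x + 1 / real (Suc n)) - w x) / (1 / real (Suc n))) \<in> borel_measurable borel" for n
    by measurable
  fix x
  have "((\<lambda>h. (w (x + h) - w x) / h) \<longlongrightarrow> deriv w x) (at 0)"
    using D[of x] by (simp add: DERIV_def)
  moreover have "filterlim (\<lambda>n. 1 / real (Suc n)) (at 0) sequentially"
    unfolding filterlim_at by (auto intro!: LIMSEQ_Suc lim_1_over_n simp del: of_nat_Suc)
  ultimately show "(\<lambda>n. (w (x + 1 / real (Suc n)) - w x) / (1 / real (Suc n))) \<longlonglongrightarrow> deriv w x"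
    by (rule filterlim_compose)
qed

text \<open>The Lipschitz constant in \<open>x\<close> is common to all times, and this upgrades
  separate to joint continuity: compare with the value at the fixed position \<open>x0\<close>, then
  let the time vary.\<close>

lemma continuous_on_Times_lipschitz:
  fixes v :: "'a :: topological_space \<Rightarrow> real \<Rightarrow> real"
  assumes t: "\<And>x. continuous_on S (\<lambda>t. v t x)"
    and x: "\<And>t x y. t \<in> S \<Longrightarrow> \<bar>v t x - v t y\<bar> \<le> B * \<bar>x - y\<bar>"
  shows "continuous_on (S \<times> UNIV) (\<lambda>(t, x). v t x)"
  unfolding continuous_on_def
proof
  fix p assume p: "p \<in> S \<times> (UNIV :: real set)"
  obtain t0 x0 where p_eq: "p = (t0, x0)" by (cases p)
  let ?F = "at p within S \<times> UNIV"
  have "continuous_on (S \<times> UNIV) (\<lambda>q. v (fst q) x0)"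
    by (rule continuous_on_compose2[OF t]) (auto intro!: continuous_intros)
  then have 1: "((\<lambda>q. v (fst q) x0) \<longlongrightarrow> v t0 x0) ?F"
    using p p_eq unfolding continuous_on_def by fastforce
  have "((\<lambda>q. B * \<bar>snd q - x0\<bar>) \<longlongrightarrow> B * \<bar>snd p - x0\<bar>) ?F"
    by (intro tendsto_intros)
  then have 2: "((\<lambda>q. B * \<bar>snd q - x0\<bar>) \<longlongrightarrow> 0) ?F" by (simp add: p_eq)
  have "((\<lambda>q. v (fst q) (snd q) - v (fst q) x0) \<longlongrightarrow> 0) ?F"
    by (rule Lim_null_comparison[OF _ 2]) (use x in \<open>auto simp: eventually_at_filter intro!: always_eventually\<close>)
  from tendsto_add[OF this 1] show "((\<lambda>(t, x). v t x) \<longlongrightarrow> (case p of (t, x) \<Rightarrow> v t x)) ?F"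
    by (simp add: p_eq case_prod_beta')
qed

definition nonlocal_density :: "(real \<Rightarrow> real) \<Rightarrow> (real \<Rightarrow> real) \<Rightarrow> (real \<Rightarrow> real) \<Rightarrow> real \<Rightarrow> real" where
  "nonlocal_density f g w y = g (w y) + deriv (deriv f) (w y) / 2 * (deriv w y)\<^sup>2"

lemma nonlocal_density_measurable:
  assumes "smooth f" "smooth g" "continuous_on UNIV w"
    and "\<And>x. (w has_real_derivative deriv w x) (at x)"
  shows "nonlocal_density f g w \<in> borel_measurable borel"
proof -
  have [measurable]: "w \<in> borel_measurable borel" "deriv w \<in> borel_measurable borel"
      "g \<in> borel_measurable borel" "deriv (deriv f) \<in> borel_measurable borel"
    using assms by (auto intro: borel_measurable_continuous_onI borel_measurable_deriv
        smooth_imp_continuous smooth_deriv)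
  show ?thesis unfolding nonlocal_density_def by measurable
qed

lemma is_solution_DERIV:
  assumes "is_solution f g T u" "t \<in> {0..T}"
  shows "((\<lambda>\<tau>. u \<tau> x) has_real_derivative
    - dx_inv_helmholtz (nonlocal_density f g (u t)) x - deriv f (u t x) * deriv (u t) x) (at t within {0..T})"
proof -
  obtain d where d: "((\<lambda>\<tau>. u \<tau> x) has_real_derivative d) (at t within {0..T})"
    "d + deriv f (u t x) * deriv (u t) x + dx_inv_helmholtz (nonlocal_density f g (u t)) x = 0"
    using assms unfolding is_solution_def nonlocal_density_def by blast
  then have "d = - dx_inv_helmholtz (nonlocal_density f g (u t)) x - deriv f (u t x) * deriv (u t) x"
    by linarith
  then show ?thesis using d(1) by simp
qed

section \<open>From an open set of zeros to a profile that vanishes identically\<close>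

lemma vanishing_profile:
  assumes f: "smooth f" and g: "smooth g" and f'': "\<And>x. deriv (deriv f) x \<ge> 0"
    and g0: "\<And>x. g x \<ge> 0" "\<And>x. g x = 0 \<longleftrightarrow> x = 0"
    and T: "T > 0" and sol: "is_solution f g T u"
    and bound: "\<And>t x. t \<in> {0..T} \<Longrightarrow> \<bar>u t x\<bar> \<le> B" "\<And>t x. t \<in> {0..T} \<Longrightarrow> \<bar>deriv (u t) x\<bar> \<le> B"
    and D: "\<And>t x. t \<in> {0..T} \<Longrightarrow> (u t has_real_derivative deriv (u t) x) (at x)"
    and \<Omega>: "openin (top_of_set ({0..T} \<times> UNIV)) \<Omega>" "\<Omega> \<noteq> {}" "\<And>t x. (t, x) \<in> \<Omega> \<Longrightarrow> u t x = 0"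
  obtains t where "t \<in> {0..T}" "\<And>x. u t x = 0"
proof -
  obtain U where U: "open U" "\<Omega> = ({0..T} \<times> UNIV) \<inter> U"
    using \<Omega>(1) by (auto simp: openin_open)
  obtain t z where tz: "t \<in> {0..T}" "(t, z) \<in> U" using \<Omega>(2) U(2) by (metis IntE SigmaE2 ex_in_conv surj_pair)
  obtain A I where AI: "open A" "open I" "t \<in> A" "z \<in> I" "A \<times> I \<subseteq> U"
    using open_prod_elim[OF U(1) tz(2)] by (metis SigmaE2 mem_Sigma_iff)
  have zero: "u \<tau> x = 0" if "\<tau> \<in> A" "\<tau> \<in> {0..T}" "x \<in> I" for \<tau> x
    using that AI(5) U(2) \<Omega>(3) by auto
  have cont: "continuous_on UNIV (u t)"
    using D[OF tz(1)] by (auto intro: DERIV_continuous_on DERIV_subset)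
  let ?h = "nonlocal_density f g (u t)"
  have meas: "?h \<in> borel_measurable borel"
    by (rule nonlocal_density_measurable[OF f g cont D[OF tz(1)]])
  have deriv0: "deriv (u t) x = 0" if "x \<in> I" for x
  proof -
    have "deriv (u t) x = deriv (\<lambda>_. 0) x"
      using eventually_nhds_in_open[OF AI(2) that] zero[OF AI(3) tz(1)]
      by (intro deriv_cong_ev) (auto elim: eventually_mono)
    then show ?thesis by simp
  qed
  have h0: "?h x = 0" if "x \<in> I" for x
    using deriv0[OF that] zero[OF AI(3) tz(1) that] g0(2)[of 0] by (simp add: nonlocal_density_def)
  have dx0: "dx_inv_helmholtz ?h x = 0" if x: "x \<in> I" for x
  proof -
    obtain e where e: "e > 0" "ball t e \<subseteq> A" using AI(1,3) open_contains_ball by blast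
    have "((\<lambda>\<tau>. u \<tau> x) has_real_derivative 0) (at t within {0..T})"
      by (rule has_field_derivative_transform_within[OF DERIV_const[of 0] e(1) tz(1)])
        (use e(2) x zero in \<open>force simp: dist_commute\<close>)
    \<comment> \<open>Uniqueness of the derivative requires \<open>t\<close> to be a limit point of
      the interval, which \<open>T > 0\<close> ensures also at the endpoints.\<close>
    moreover have "at t within {0..T} \<noteq> bot"
      using T tz(1) by (simp add: trivial_limit_within)
    ultimately have "- dx_inv_helmholtz ?h x - deriv f (u t x) * deriv (u t) x = 0"
      using is_solution_DERIV[OF sol tz(1), of x] vector_derivative_unique_within
      unfolding has_real_derivative_iff_has_vector_derivative by blast
    then show ?thesis using deriv0[OF x] by simp
  qed
  obtain e where e: "e > 0" "cball z e \<subseteq> I" using AI(2,4) open_contains_cball by blast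
  then have sub: "{z..z + e} \<subseteq> I" by (force simp: dist_real_def)
  obtain G where G: "\<And>x. \<bar>x\<bar> \<le> B \<Longrightarrow> \<bar>g x\<bar> \<le> G"
    using continuous_abs_bounded_on_Icc[OF smooth_imp_continuous[OF g], of B] by metis
  obtain L where L0: "L > 0" and L: "\<And>x. \<bar>x\<bar> \<le> B \<Longrightarrow> \<bar>deriv (deriv f) x\<bar> \<le> L"
    using continuous_abs_bounded_on_Icc[OF smooth_imp_continuous[OF smooth_deriv[OF smooth_deriv[OF f]]], of B]
    by metis
  have h_nonneg: "0 \<le> ?h y" for y
    using g0(1) f'' by (auto simp: nonlocal_density_def)
  have "\<bar>?h y\<bar> \<le> G + L / 2 * B\<^sup>2" for y
  proof -
    note b = bound[OF tz(1), of y]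
    have "deriv (deriv f) (u t y) / 2 * (deriv (u t) y)\<^sup>2 \<le> L / 2 * B\<^sup>2"
      using L[OF b(1)] L0 b(2) f'' by (intro mult_mono) (auto simp: abs_le_square_iff[symmetric])
    then show ?thesis
      using G[OF b(1)] h_nonneg[of y] by (simp add: nonlocal_density_def)
  qed
  from AE_zero_if_dx_inv_helmholtz_const[OF meas this h_nonneg, of z "z + e"]
  have "AE y in lborel. ?h y = 0"
    using e(1) h0 dx0 sub by (simp add: subset_iff)
  then have "AE y in lborel. y \<in> {y. u t y = 0}"
  proof eventually_elim
    case (elim y)
    then have "g (u t y) = 0"
      using g0(1)[of "u t y"] f''[of "u t y"] unfolding nonlocal_density_def
      by (metis add_nonneg_eq_0_iff divide_nonneg_nonneg mult_nonneg_nonneg zero_le_numeral zero_le_power2)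
    then show ?case using g0(2) by simp
  qed
  \<comment> \<open>From almost every to every point: a closed set of full measure is the whole
    line.\<close>
  moreover have "closed {y. u t y = 0}"
    using closed_Collect_eq[OF cont continuous_on_const] by simp
  ultimately have "u t x = 0" for x
    using mem_closed_if_AE_lebesgue[of "{y. u t y = 0}" x] AE_completion by blast
  then show ?thesis using that tz(1) by blast
qed

text \<open>Since \<open>g 0 = 0\<close>, the first term is at most \<open>G * m\<close>; in the
  squared derivative one factor is estimated by \<open>B\<close> and the other by \<open>m\<close>.
  Linearity in \<open>m\<close> is what later makes the time step independent of
  \<open>m\<close>.\<close>

lemma nonlocal_density_le:
  assumes g: "smooth g" "g 0 = 0" and f'': "\<And>x. \<bar>x\<bar> \<le> B \<Longrightarrow> \<bar>deriv (deriv f) x\<bar> \<le> L"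
    and g': "\<And>x. \<bar>x\<bar> \<le> B \<Longrightarrow> \<bar>deriv g x\<bar> \<le> G"
    and m: "\<bar>w y\<bar> \<le> m" "\<bar>deriv w y\<bar> \<le> m" "m \<le> B"
  shows "\<bar>nonlocal_density f g w y\<bar> \<le> (G + L * B) * m"
proof -
  have B: "0 \<le> B" "0 \<le> m" using m by linarith+
  have wB: "\<bar>w y\<bar> \<le> B" using m by linarith
  have "\<bar>g (w y) - g 0\<bar> \<le> G * \<bar>w y - 0\<bar>"
    using smooth_imp_DERIV[OF g(1)] g' wB B by (intro DERIV_bounded_imp_lipschitz_on_Icc[where B = B]) auto
  also have "\<dots> \<le> G * m"
    using m(1) g'[of 0] B by (intro mult_left_mono) auto
  finally have 1: "\<bar>g (w y)\<bar> \<le> G * m" using g(2) by simp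
  have "\<bar>deriv (deriv f) (w y) / 2 * (deriv w y)\<^sup>2\<bar> = \<bar>deriv (deriv f) (w y)\<bar> / 2 * (\<bar>deriv w y\<bar> * \<bar>deriv w y\<bar>)"
    by (simp add: abs_mult power2_eq_square)
  also have "\<dots> \<le> L * (B * m)"
    using f''[OF wB] m B by (intro mult_mono) auto
  finally show ?thesis
    using 1 unfolding nonlocal_density_def by (simp add: algebra_simps)
qed

text \<open>The sign \<open>\<sigma> = -1\<close> runs time backwards. The length \<open>d\<close> does not depend on \<open>m\<close>, so that the
  improvement from \<open>m\<close> to \<open>m / 2\<close> can be iterated on a fixed time interval.\<close>

lemma C1_bound_halving:
  assumes f: "smooth f" and g: "smooth g" "g 0 = 0"
    and sol: "is_solution f g T u"
    and bound: "\<And>t x. t \<in> {0..T} \<Longrightarrow> \<bar>u t x\<bar> \<le> B" "\<And>t x. t \<in> {0..T} \<Longrightarrow> \<bar>deriv (u t) x\<bar> \<le> B"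
    and D: "\<And>t x. t \<in> {0..T} \<Longrightarrow> (u t has_real_derivative deriv (u t) x) (at x)"
    and B: "B \<ge> 0"
  obtains d where "d > 0"
    and "\<And>\<sigma> t \<delta> m \<tau> x. \<lbrakk>\<bar>\<sigma>\<bar> = 1; \<delta> \<le> d; \<And>\<tau>. \<tau> \<in> {0..\<delta>} \<Longrightarrow> t + \<sigma> * \<tau> \<in> {0..T};
      \<And>x. u t x = 0; m \<le> B; \<And>\<tau> x. \<tau> \<in> {0..\<delta>} \<Longrightarrow> \<bar>u (t + \<sigma> * \<tau>) x\<bar> \<le> m;
      \<And>\<tau> x. \<tau> \<in> {0..\<delta>} \<Longrightarrow> \<bar>deriv (u (t + \<sigma> * \<tau>)) x\<bar> \<le> m; \<tau> \<in> {0..\<delta>}\<rbrakk>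
      \<Longrightarrow> \<bar>u (t + \<sigma> * \<tau>) x\<bar> \<le> m / 2 \<and> \<bar>deriv (u (t + \<sigma> * \<tau>)) x\<bar> \<le> m / 2"
proof -
  obtain L where L0: "L > 0" and L: "\<And>x. \<bar>x\<bar> \<le> B \<Longrightarrow> \<bar>deriv (deriv f) x\<bar> \<le> L"
    using continuous_abs_bounded_on_Icc[OF smooth_imp_continuous[OF smooth_deriv[OF smooth_deriv[OF f]]], of B]
    by metis
  obtain A where A0: "A > 0" and A: "\<And>x. \<bar>x\<bar> \<le> B \<Longrightarrow> \<bar>deriv f x\<bar> \<le> A"
    using continuous_abs_bounded_on_Icc[OF smooth_imp_continuous[OF smooth_deriv[OF f]], of B] by metis
  obtain G where G0: "G > 0" and G: "\<And>x. \<bar>x\<bar> \<le> B \<Longrightarrow> \<bar>deriv g x\<bar> \<le> G"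
    using continuous_abs_bounded_on_Icc[OF smooth_imp_continuous[OF smooth_deriv[OF g(1)]], of B] by metis
  define E where "E = (LINT y|lborel. exp (- \<bar>y :: real\<bar>))"
  define H where "H = G + L * B"
  \<comment> \<open>The sum of three rates, each of which gets \<open>\<delta>\<close> times it
    below 1: the first gives \<open>\<delta> * (L * B) \<le> 1 / 2\<close> for the maximum
    principle, the second the slope \<open>4 * M * \<delta> \<le> m / 2\<close>, the third the
    change of \<open>v\<close> by at most \<open>m / 2\<close>.\<close>
  define S where "S = 2 * (L * B) + 8 * (H * (2 * E + 1)) + 2 * (H * E + A)"
  have E0: "E \<ge> 0" unfolding E_def by (intro integral_nonneg_AE) auto
  have H0: "H > 0" using G0 L0 B by (simp add: H_def add_pos_nonneg)
  have parts: "0 \<le> L * B" "0 \<le> H * (2 * E + 1)" "0 < H * E + A"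
    using L0 B H0 E0 A0 by (auto intro: add_nonneg_pos)
  have S0: "S > 0" using parts by (simp add: S_def)
  show ?thesis
  proof (rule that[of "1 / S"])
    show "1 / S > 0" using S0 by simp
  next
    fix \<sigma> t \<delta> m \<tau> x
    assume \<sigma>: "\<bar>\<sigma>\<bar> = (1::real)" and \<delta>: "\<delta> \<le> 1 / S"
      and range: "\<And>\<tau>. \<tau> \<in> {0..\<delta>} \<Longrightarrow> t + \<sigma> * \<tau> \<in> {0..T}"
      and init: "\<And>x. u t x = 0" and mB: "m \<le> B"
      and m: "\<And>\<tau> x. \<tau> \<in> {0..\<delta>} \<Longrightarrow> \<bar>u (t + \<sigma> * \<tau>) x\<bar> \<le> m"
        "\<And>\<tau> x. \<tau> \<in> {0..\<delta>} \<Longrightarrow> \<bar>deriv (u (t + \<sigma> * \<tau>)) x\<bar> \<le> m"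
      and \<tau>: "\<tau> \<in> {0..\<delta>}"
    have m0: "m \<ge> 0" using m(1)[OF \<tau>, of x] by linarith
    have \<delta>0: "\<delta> \<ge> 0" using \<tau> by auto
    have \<delta>S: "\<delta> * S \<le> 1" using \<delta> S0 by (simp add: field_simps)
    have \<delta>_le: "\<delta> * c \<le> 1" if "c \<le> S" for c
      using mult_left_mono[OF that \<delta>0] \<delta>S by linarith
    define v where "v \<tau> = u (t + \<sigma> * \<tau>)" for \<tau>
    \<comment> \<open>The factor \<open>\<sigma>\<close> in velocity and source makes the reversed
      evolution a transport equation of the same form.\<close>
    define a where "a \<tau> x = \<sigma> * deriv f (v \<tau> x)" for \<tau> x
    define F where "F \<tau> x = - \<sigma> * dx_inv_helmholtz (nonlocal_density f g (v \<tau>)) x" for \<tau> x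
    have vB: "\<bar>v \<tau> x\<bar> \<le> B" "\<bar>deriv (v \<tau>) x\<bar> \<le> B" if "\<tau> \<in> {0..\<delta>}" for \<tau> x
      using bound[OF range[OF that]] by (auto simp: v_def)
    have dx: "(v \<tau> has_real_derivative deriv (v \<tau>) x) (at x)" if "\<tau> \<in> {0..\<delta>}" for \<tau> x
      using D[OF range[OF that]] by (simp add: v_def)
    have lip: "\<bar>v \<tau> x - v \<tau> y\<bar> \<le> B * \<bar>x - y\<bar>" if "\<tau> \<in> {0..\<delta>}" for \<tau> x y
      using field_differentiable_bound[of UNIV "v \<tau>" "deriv (v \<tau>)" B x y] dx[OF that] vB(2)[OF that] by simp
    have dt: "((\<lambda>\<tau>. v \<tau> x) has_real_derivative F \<tau> x - a \<tau> x * deriv (v \<tau>) x) (at \<tau> within {0..\<delta>})"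
      if "\<tau> \<in> {0..\<delta>}" for \<tau> x
    proof -
      have "((\<lambda>s. u s x) has_real_derivative
          - dx_inv_helmholtz (nonlocal_density f g (v \<tau>)) x - deriv f (v \<tau> x) * deriv (v \<tau>) x)
          (at (t + \<sigma> * \<tau>) within (\<lambda>\<tau>. t + \<sigma> * \<tau>) ` {0..\<delta>})"
        unfolding v_def by (rule DERIV_subset[OF is_solution_DERIV[OF sol range[OF that]]]) (use range in auto)
      moreover have "((\<lambda>\<tau>. t + \<sigma> * \<tau>) has_real_derivative \<sigma>) (at \<tau> within {0..\<delta>})"
        by (auto intro!: derivative_eq_intros)
      ultimately show ?thesis
        by (drule_tac DERIV_image_chain) (auto simp: comp_def v_def F_def a_def algebra_simps)
    qed
    have h: "\<bar>nonlocal_density f g (v \<tau>) y\<bar> \<le> H * m" if "\<tau> \<in> {0..\<delta>}" for \<tau> y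
      unfolding H_def using m[OF that] mB by (intro nonlocal_density_le[OF g L G]) (auto simp: v_def)
    have meas: "nonlocal_density f g (v \<tau>) \<in> borel_measurable borel" if "\<tau> \<in> {0..\<delta>}" for \<tau>
      using dx[OF that]
      by (intro nonlocal_density_measurable f g) (auto intro: DERIV_continuous_on DERIV_subset)
    have F_le: "\<bar>F \<tau> x\<bar> \<le> H * m * E" if "\<tau> \<in> {0..\<delta>}" for \<tau> x
      using dx_inv_helmholtz_bound[OF meas[OF that] h[OF that]] \<sigma> by (simp add: F_def E_def abs_mult)
    have F_lip: "\<bar>F \<tau> x - F \<tau> y\<bar> \<le> H * m * (2 * E + 1) * \<bar>x - y\<bar>" if "\<tau> \<in> {0..\<delta>}" for \<tau> x y
    proof -
      have "F \<tau> x - F \<tau> y = - \<sigma> * (dx_inv_helmholtz (nonlocal_density f g (v \<tau>)) x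
          - dx_inv_helmholtz (nonlocal_density f g (v \<tau>)) y)"
        by (simp add: F_def algebra_simps)
      then show ?thesis
        using dx_inv_helmholtz_lipschitz[OF meas[OF that] h[OF that], of x y] \<sigma>
        by (simp add: E_def abs_mult)
    qed
    have a_le: "\<bar>a \<tau> x\<bar> \<le> A" if "\<tau> \<in> {0..\<delta>}" for \<tau> x
      using A[OF vB(1)[OF that]] \<sigma> by (simp add: a_def abs_mult)
    have a_lip: "\<bar>a \<tau> x - a \<tau> y\<bar> \<le> (L * B) * \<bar>x - y\<bar>" if "\<tau> \<in> {0..\<delta>}" for \<tau> x y
    proof -
      have "a \<tau> x - a \<tau> y = \<sigma> * (deriv f (v \<tau> x) - deriv f (v \<tau> y))"
        by (simp add: a_def algebra_simps)
      then have "\<bar>a \<tau> x - a \<tau> y\<bar> = \<bar>deriv f (v \<tau> x) - deriv f (v \<tau> y)\<bar>"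
        using \<sigma> by (simp add: abs_mult)
      also have "\<dots> \<le> L * \<bar>v \<tau> x - v \<tau> y\<bar>"
        by (rule DERIV_bounded_imp_lipschitz_on_Icc[OF smooth_imp_DERIV[OF smooth_deriv[OF f]] L
              vB(1)[OF that] vB(1)[OF that]])
      also have "\<dots> \<le> L * (B * \<bar>x - y\<bar>)"
        using lip[OF that] L0 by (intro mult_left_mono) auto
      finally show ?thesis by simp
    qed
    have sup: "\<bar>v \<tau> x\<bar> \<le> m / 2"
    proof -
      have "\<bar>F \<tau> x - a \<tau> x * deriv (v \<tau>) x\<bar> \<le> (H * E + A) * m" if "\<tau> \<in> {0..\<delta>}" for \<tau>
      proof -
        have "\<bar>a \<tau> x * deriv (v \<tau>) x\<bar> \<le> A * m"
          unfolding abs_mult using a_le[OF that] m(2)[OF that] A0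
          by (intro mult_mono) (auto simp: v_def)
        then show ?thesis using F_le[OF that, of x] by (simp add: algebra_simps)
      qed
      then have "norm (v \<tau> x - v 0 x) \<le> (H * E + A) * m * norm (\<tau> - 0)"
        using dt \<tau> \<delta>0 by (intro field_differentiable_bound[of "{0..\<delta>}"]) auto
      also have "\<dots> \<le> (H * E + A) * m * \<delta>"
        using \<tau> parts m0 by (intro mult_left_mono) auto
      also have "\<dots> = (\<delta> * (2 * (H * E + A))) * m / 2" by simp
      also have "\<dots> \<le> 1 * m / 2"
        using m0 parts by (intro divide_right_mono mult_right_mono \<delta>_le) (auto simp: S_def)
      finally show ?thesis using init by (simp add: v_def)
    qed
    have "\<bar>deriv (v \<tau>) x\<bar> \<le> m / 2"
    \<comment> \<open>The maximum principle requires a positive constant for the source, and the one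
      at hand is proportional to \<open>m\<close>.\<close>
    proof (cases "m = 0")
      case True
      then show ?thesis using m(2)[OF \<tau>, of x] by (simp add: v_def)
    next
      case False
      define M where "M = H * m * (2 * E + 1)"
      have M: "M > 0" using False m0 H0 E0 by (simp add: M_def)
      have cont: "continuous_on ({0..\<delta>} \<times> UNIV) (\<lambda>(\<tau>, x). v \<tau> x)"
        by (rule continuous_on_Times_lipschitz[OF DERIV_continuous_on[OF dt] lip])
      have "\<delta> * (2 * (L * B)) \<le> 1"
        by (rule \<delta>_le) (use parts in \<open>simp add: S_def\<close>)
      then have \<delta>L: "\<delta> * (L * B) \<le> 1 / 2" by simp
      have v_lip: "v \<tau> x - v \<tau> y \<le> 4 * M * \<tau> * \<bar>x - y\<bar>" for x y
        using transport_lipschitz_bound[OF parts(1) \<delta>L M A0 cont, where F = F and a = a and v' = "\<lambda>\<tau>. deriv (v \<tau>)"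
            and B = B and t = \<tau> and x = x and y = y]
          vB(1) init dt dx a_le a_lip F_lip \<tau> by (simp add: M_def v_def)
      have "4 * M * \<tau> \<le> 4 * M * \<delta>" using M \<tau> by simp
      also have "\<dots> = (\<delta> * (8 * (H * (2 * E + 1)))) * m / 2" by (simp add: M_def)
      also have "\<dots> \<le> 1 * m / 2"
        using m0 parts by (intro divide_right_mono mult_right_mono \<delta>_le) (auto simp: S_def)
      finally have "4 * M * \<tau> * \<bar>x - y\<bar> \<le> m / 2 * \<bar>x - y\<bar>" for x y
        by (intro mult_right_mono) auto
      then have "\<bar>v \<tau> x - v \<tau> y\<bar> \<le> m / 2 * \<bar>x - y\<bar>" for y
        using v_lip[of x y] v_lip[of y x] by (smt (verit) abs_minus_commute)
      then show ?thesis by (rule abs_DERIV_le_lipschitz[OF dx[OF \<tau>]])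
    qed
    then show "\<bar>u (t + \<sigma> * \<tau>) x\<bar> \<le> m / 2 \<and> \<bar>deriv (u (t + \<sigma> * \<tau>)) x\<bar> \<le> m / 2"
      using sup by (simp add: v_def)
  qed
qed

section \<open>Propagation of the zero profile through the whole time interval\<close>

lemma vanishing_propagates:
  assumes f: "smooth f" and g: "smooth g" "g 0 = 0"
    and sol: "is_solution f g T u"
    and bound: "\<And>t x. t \<in> {0..T} \<Longrightarrow> \<bar>u t x\<bar> \<le> B" "\<And>t x. t \<in> {0..T} \<Longrightarrow> \<bar>deriv (u t) x\<bar> \<le> B"
    and D: "\<And>t x. t \<in> {0..T} \<Longrightarrow> (u t has_real_derivative deriv (u t) x) (at x)"
    and s: "s \<in> {0..T}" "\<And>x. u s x = 0" and t: "t \<in> {0..T}"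
  shows "u t x = 0"
proof -
  have B: "B \<ge> 0" using bound(1)[OF s(1), of 0] by linarith
  show ?thesis
  proof (rule C1_bound_halving[OF f g sol bound D B])
    fix d :: real assume d: "d > 0" and half:
      "\<And>\<sigma> t \<delta> m \<tau> x. \<lbrakk>\<bar>\<sigma>\<bar> = 1; \<delta> \<le> d; \<And>\<tau>. \<tau> \<in> {0..\<delta>} \<Longrightarrow> t + \<sigma> * \<tau> \<in> {0..T};
        \<And>x. u t x = 0; m \<le> B; \<And>\<tau> x. \<tau> \<in> {0..\<delta>} \<Longrightarrow> \<bar>u (t + \<sigma> * \<tau>) x\<bar> \<le> m;
        \<And>\<tau> x. \<tau> \<in> {0..\<delta>} \<Longrightarrow> \<bar>deriv (u (t + \<sigma> * \<tau>)) x\<bar> \<le> m; \<tau> \<in> {0..\<delta>}\<rbrakk>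
        \<Longrightarrow> \<bar>u (t + \<sigma> * \<tau>) x\<bar> \<le> m / 2 \<and> \<bar>deriv (u (t + \<sigma> * \<tau>)) x\<bar> \<le> m / 2"
    have step: "u r x = 0" if r: "r \<in> {0..T}" "\<And>x. u q x = 0" "q \<in> {0..T}" "\<bar>r - q\<bar> \<le> d" for q r x
    proof -
      define \<sigma> where "\<sigma> = (if q \<le> r then 1 else - 1 :: real)"
      define \<delta> where "\<delta> = \<bar>r - q\<bar>"
      have \<sigma>: "\<bar>\<sigma>\<bar> = 1" "q + \<sigma> * \<delta> = r" by (auto simp: \<sigma>_def \<delta>_def)
      have range: "q + \<sigma> * \<tau> \<in> {0..T}" if "\<tau> \<in> {0..\<delta>}" for \<tau>
        using that r by (auto simp: \<sigma>_def \<delta>_def)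
      \<comment> \<open>Every round reuses the same interval, starting again from the zero profile
        at \<open>q\<close>, so the bounds shrink while the interval does not.\<close>
      have "\<forall>\<tau>\<in>{0..\<delta>}. \<forall>x. \<bar>u (q + \<sigma> * \<tau>) x\<bar> \<le> B / 2 ^ n \<and> \<bar>deriv (u (q + \<sigma> * \<tau>)) x\<bar> \<le> B / 2 ^ n" for n
      proof (induction n)
        case 0
        then show ?case using bound range by simp
      next
        case (Suc n)
        have "B / 2 ^ n \<le> B"
          using B by (simp add: divide_le_eq mult_le_cancel_left1)
        from half[OF \<sigma>(1) _ range r(2) this] Suc.IH r(4) show ?case
          by (simp add: \<delta>_def mult.commute)
      qed
      then have le: "\<bar>u r x\<bar> \<le> B / 2 ^ n" for n
        using \<sigma>(2) by (metis \<delta>_def abs_ge_zero atLeastAtMost_iff order_refl)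
      have "(\<lambda>n. B / 2 ^ n) \<longlonglongrightarrow> 0" by real_asymp
      then have "\<bar>u r x\<bar> \<le> 0" by (rule LIMSEQ_le_const) (use le in auto)
      then show ?thesis by simp
    qed
    have "\<forall>r\<in>{0..T}. \<bar>r - s\<bar> \<le> real n * d \<longrightarrow> (\<forall>x. u r x = 0)" for n
    proof (induction n)
      case 0
      then show ?case using s(2) by auto
    next
      case (Suc n)
      show ?case
      proof (intro ballI impI allI)
        fix r x assume r: "r \<in> {0..T}" "\<bar>r - s\<bar> \<le> real (Suc n) * d"
        \<comment> \<open>Cut the way from \<open>s\<close> to \<open>r\<close> into
          \<open>Suc n\<close> equal pieces and stop before the last one. The induction hypothesis
          reaches \<open>q\<close>, one step of length at most \<open>d\<close> remains, and the
          signed difference handles both directions.\<close>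
        define q where "q = s + (r - s) * (real n / real (Suc n))"
        have q_s: "q - s = (r - s) * (real n / real (Suc n))" by (simp add: q_def)
        have r_q: "r - q = (r - s) * (1 / real (Suc n))" by (simp add: q_def field_simps)
        have "\<bar>q - s\<bar> \<le> real (Suc n) * d * (real n / real (Suc n))"
          unfolding q_s abs_mult using r(2) by (intro mult_mono) auto
        then have 1: "\<bar>q - s\<bar> \<le> real n * d" by (simp add: mult.commute del: of_nat_Suc)
        have "\<bar>r - q\<bar> \<le> real (Suc n) * d * (1 / real (Suc n))"
          unfolding r_q abs_mult using r(2) by (intro mult_mono) auto
        then have 2: "\<bar>r - q\<bar> \<le> d" by (simp del: of_nat_Suc)
        have "q = (1 - real n / real (Suc n)) *\<^sub>R s + (real n / real (Suc n)) *\<^sub>R r"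
          by (simp add: q_def algebra_simps diff_divide_distrib)
        also have "\<dots> \<in> {0..T}"
          using s(1) r(1) by (intro convexD[OF convex_real_interval(5)]) auto
        finally show "u r x = 0"
          using step[OF r(1) _ _ 2] Suc.IH 1 by blast
      qed
    qed
    moreover obtain n where "\<bar>t - s\<bar> \<le> real n * d"
      using reals_Archimedean3[OF d] less_imp_le by metis
    ultimately show "u t x = 0" using t by blast
  qed
qed

theorem corollary2p1:
  fixes f g :: "real \<Rightarrow> real" and u :: "real \<Rightarrow> real \<Rightarrow> real"
    and T s :: real and \<Omega> :: "(real \<times> real) set"
  assumes "smooth f" and "smooth g"
    and "f 0 = 0" and "\<And>x. deriv (deriv f) x \<ge> 0"
    and "\<And>x. g x \<ge> 0" and "\<And>x. g x = 0 \<longleftrightarrow> x = 0"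
    and "T > 0" and "s > 3 / 2"
    and "u \<in> C0_sobolev T s"
    and "\<And>t. t \<in> {0..T} \<Longrightarrow> continuous_on UNIV (u t)"
    and "is_solution f g T u"
    and "openin (top_of_set ({0..T} \<times> UNIV)) \<Omega>" and "\<Omega> \<noteq> {}"
    and "\<And>t x. (t, x) \<in> \<Omega> \<Longrightarrow> u t x = 0"
  shows "\<forall>t\<in>{0..T}. \<forall>x. u t x = 0"
proof -
  \<comment> \<open>Where no derivative exists, \<open>deriv\<close> has an uninformative value; the
    embedding makes it a genuine derivative at every point.\<close>
  have D: "(u t has_real_derivative deriv (u t) x) (at x)" if t: "t \<in> {0..T}" for t x
  proof -
    have "u t \<in> sobolev s"
      using assms(9) t by (auto simp: C0_sobolev_def)
    then have "u t differentiable (at x)"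
      using assms(8) assms(10)[OF t] by (rule sobolev_embedding_C1(1))
    then show ?thesis
      by (metis DERIV_imp_deriv real_differentiable_def)
  qed
  obtain B where B: "\<And>t x. t \<in> {0..T} \<Longrightarrow> \<bar>u t x\<bar> \<le> B"
      "\<And>t x. t \<in> {0..T} \<Longrightarrow> \<bar>deriv (u t) x\<bar> \<le> B"
    using C0_sobolev_uniform_C1_bound[OF assms(9,8,10)] by metis
  obtain t where t: "t \<in> {0..T}" "\<And>x. u t x = 0"
    using vanishing_profile[OF assms(1,2,4-7,11) B D assms(12-14)] by metis
  have "g 0 = 0"
    using assms(6) by simp
  then show ?thesis
    using vanishing_propagates[OF assms(1,2) _ assms(11) B D t] by blast
qed

end
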